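(* Assume the following. (i) For any $j\in\{1,\dots,d\}$, the partial derivative $\dot C_j=\partial C/\partial u_j$ exists and is continuous on $V_j=\{\mathbf u\in[0,1]^d:u_j\in(0,1)\}$. (ii) The process $\mathbb B_n(0,\cdot,\cdot)$ converges weakly in $\ell^\infty([0,1]^{d+1})$ to a tight centered Gaussian process $\mathbb Z_C$ concentrated on the set of continuous $f:[0,1]^{d+1}\to\mathbb R$ such that $f(s,\mathbf u)=0$ if one of the components of $(s,\mathbf u)$ is 0, and $f(s,1,\dots,1)=0$ for all $s\in(0,1]$. (iii) There exist positive sequences $b_n\downarrow0$ and $b_n'\downarrow0$ and constants $L_2\ge L_1>0$ such that, for all $n\in\mathbb N$, $b_n+b_n'\ge n^{-1/2}$ and, for any $\mathbf x\in(\mathbb R^d)^n$, $L_1b_n\le h(\mathbf x)\le(L_2b_n)\wedge1/2$ and $L_1b_n'\le h'(\mathbf x)\le(L_2b_n')\wedge1/2$. (iv) There exists a positive sequence $a_n\downarrow0$ such that, for any $n\in\mathbb N$, $\mathbf x\in(\mathbb R^d)^n$, $\mathbf u\in[0,1]^d$ and $j\in\{1,\dots,d\}$, $\mathrm{Var}(W_{j,u_j}^{\mathbf x})\le a_n$. Then, for any $j\in\{1,\dots,d\}$, $\delta\in(0,1)$ and $\varepsilon\in(0,1/2)$, $$\sup_{(s,t)\in\Lambda,\;t-s\ge\delta}\ \sup_{\mathbf u\in[0,1]^d,\;u_j\in[\varepsilon,1-\varepsilon]}\left|\underline{\dot C}_{j,\lfloor ns\rfloor+1:\lfloor nt\rfloor}^{\Delta,\nu}(\mathbf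 u)-\dot C_j(\mathbf u)\right|=o_{\Pr}(1),$$ and the same holds with $\underline{\dot C}_{j,\lfloor ns\rfloor+1:\lfloor nt\rfloor}^{\Delta,\nu}$ replaced by $\underline{\dot C}_{j,\lfloor ns\rfloor+1:\lfloor nt\rfloor}^{\nabla,\nu}$.
   Context: Setting. $(\mathbf X_i)_{i\in\mathbb Z}$ is a $d$-dimensional stationary time series of continuous random vectors $\mathbf X_i=(X_{i1},\dots,X_{id})$ with d.f. $F$, continuous univariate margins $F_1,\dots,F_d$, and unique copula $C$. For $1\le k\le l\le n$, $\mathcal X_{k:l}=(\mathbf X_k,\dots,\mathbf X_l)$. Inequalities between vectors are componentwise; $\wedge$, $\vee$ are (componentwise) minimum and maximum. All limits are as $n\to\infty$; weak convergence is in the sense of van der Vaart and Wellner (1996, Definition 1.3.3); $\ell^\infty(T)$ is the space of bounded real functions on $T$ with the uniform metric. $\Lambda=\{(s,t)\in[0,1]^2:s\le t\}$. $\dot C_j$ is set to 0 on $\{\mathbf u\in[0,1]^d:u_j\in\{0,1\}\}$. With $\mathbf U_i=(F_1(X_{i1}),\dots,F_d(X_{id}))$, $\mathbb B_n(s,t,\mathbf u)=n^{-1/2}\sum_{i=\lfloor ns\rfloor+1}^{\lfloor nt\rfloor}\{\mathbf 1(\mathbf U_i\le\mathbf u)-C(\mathbf u)\}$ (zero for empty sums). Empirical copula. $R_{ij}^{k:l}=\sum_{t=k}^l\mathbf 1(X_{tj}\le X_{ij})$, $\mathbf R_i^{k:l}=(R_{i1}^{k:l},\dots,R_{id}^{k:l})$,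 $C_{k:l}(\mathbf u)=\frac1{l-k+1}\sum_{i=k}^l\mathbf 1\{\mathbf R_i^{k:l}/(l-k+1)\le\mathbf u\}$, and $C_{k:l}=0$ if $k>l$. Smoothing. For $m\in\mathbb N$, $\mathbf x\in(\mathbb R^d)^m$, $\mathbf u\in[0,1]^d$, $\nu_{\mathbf u}^{\mathbf x}$ is the law of a $[0,1]^d$-valued random vector $\mathbf W_{\mathbf u}^{\mathbf x}=(W_{1,u_1}^{\mathbf x},\dots,W_{d,u_d}^{\mathbf x})$ with mean $\mathbf u$, whose $j$th component depends on $\mathbf u$ only through $u_j$. Standing assumption: there are a fixed integer $p\ge d$, a random vector $\mathbf U$ with $p$ independent standard uniform components, independent of $\mathcal X_{1:n}$, and functions $\mathcal W_{\mathbf u}^{\mathbf x}:[0,1]^p\to[0,1]^d$ with $\mathbf W_{\mathbf u}^{\mathbf x}=\mathcal W_{\mathbf u}^{\mathbf x}(\mathbf U)$. $\nu_{\mathbf u}^{\mathcal X_{k:l}}$ denotes $\nu_{\mathbf u}^{\mathbf x}$ with $\mathbf x=\mathcal X_{k:l}$ (the Dirac measure at $\mathbf u$ if $k>l$). Estimators. For any $n\in\mathbb N$ and potential data set $\mathbf x\in(\mathbb R^d)^n$, $h(\mathbf x),h'(\mathbf x)\in[0,1/2]$ are the right and left bandwidths for the data set $\mathbf x$. Below, for a stretch $\mathcal X_{k:l}$, $h=h(\mathcal X_{k:l})$ and $h'=h'(\mathcal X_{k:l})$ (random variables, $h+h'>0$); $\mathbf e_j$ is the $j$th canonical basis vector of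 $\mathbb R^d$, $\mathbf 0=(0,\dots,0)$, $\mathbf 1=(1,\dots,1)$: $$\dot C_{j,k:l}^{\nabla}(\mathbf u)=\frac{C_{k:l}\{(\mathbf u+h\mathbf e_j)\wedge\mathbf 1\}-C_{k:l}\{(\mathbf u-h'\mathbf e_j)\vee\mathbf 0\}}{h+h'},$$ $$\dot C_{j,k:l}^{\Delta}(\mathbf u)=\frac{C_{k:l}\{(\mathbf u+h\mathbf e_j)\wedge\mathbf 1\}-C_{k:l}\{(\mathbf u-h'\mathbf e_j)\vee\mathbf 0\}}{(u_j+h)\wedge1-(u_j-h')\vee0},$$ $\underline{\dot C}_{j,k:l}^{\nabla}=(\dot C_{j,k:l}^{\nabla}\vee0)\wedge1$, $\underline{\dot C}_{j,k:l}^{\Delta}=(\dot C_{j,k:l}^{\Delta}\vee0)\wedge1$, and $$\underline{\dot C}_{j,k:l}^{\nabla,\nu}(\mathbf u)=\int_{[0,1]^d}\underline{\dot C}_{j,k:l}^{\nabla}(\mathbf w)\,d\nu_{\mathbf u}^{\mathcal X_{k:l}}(\mathbf w),\qquad\underline{\dot C}_{j,k:l}^{\Delta,\nu}(\mathbf u)=\int_{[0,1]^d}\underline{\dot C}_{j,k:l}^{\Delta}(\mathbf w)\,d\nu_{\mathbf u}^{\mathcal X_{k:l}}(\mathbf w).$$ *)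

theory Defs
  imports "HOL-Probability.Probability"
begin

section \<open>Outer probability and weak convergence in spaces of bounded functions\<close>

text \<open>
  Outer expectation of a map that need not be measurable. It is only applied to bounded maps, for
  which restricting the infimum to integrable real-valued majorants does not change its value.
\<close>

definition outer_expectation :: "'a measure \<Rightarrow> ('a \<Rightarrow> real) \<Rightarrow> real" where
  "outer_expectation M Y =
     Inf {integral\<^sup>L M G | G. integrable M G \<and> (\<forall>\<omega>\<in>space M. Y \<omega> \<le> G \<omega>)}"

text \<open>
  \<open>o\<^sub>P(1)\<close>. The suprema to which this is applied need not be measurable, hence the outer probability
  (which is the probability whenever the event is measurable).
\<close>

definition tendsto_zero_outer_prob :: "'a measure \<Rightarrow> (nat \<Rightarrow> 'a \<Rightarrow> real) \<Rightarrow> bool" where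
  "tendsto_zero_outer_prob M Y \<longleftrightarrow>
     (\<forall>\<eta>>0. (\<lambda>n. outer_measure_of M {\<omega> \<in> space M. \<bar>Y n \<omega>\<bar> > \<eta>}) \<longlonglongrightarrow> 0)"

text \<open>
  Bounded functions on a set \<open>T\<close> are represented by their extensional versions (\<open>undefined\<close> outside
  \<open>T\<close>), so that the uniform distance separates points. The default value of the distance only
  matters for \<open>T = {}\<close> and outside \<open>linf T\<close>.
\<close>

definition linf :: "'t set \<Rightarrow> ('t \<Rightarrow> real) set" where
  "linf T = {f \<in> extensional T. bounded (f ` T)}"

definition linf_dist :: "'t set \<Rightarrow> ('t \<Rightarrow> real) \<Rightarrow> ('t \<Rightarrow> real) \<Rightarrow> real" where
  "linf_dist T f g =
     (if T \<noteq> {} \<and> f \<in> linf T \<and> g \<in> linf T then SUP t\<in>T. \<bar>f t - g t\<bar> else 0)"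

lemma linf_dist_upper:
  assumes "f \<in> linf T" "g \<in> linf T" "t \<in> T"
  shows "\<bar>f t - g t\<bar> \<le> linf_dist T f g"
proof -
  obtain a b where "\<forall>t\<in>T. \<bar>f t\<bar> \<le> a" "\<forall>t\<in>T. \<bar>g t\<bar> \<le> b"
    using assms by (auto simp: linf_def bounded_iff)
  then have "bdd_above ((\<lambda>t. \<bar>f t - g t\<bar>) ` T)"
    by (intro bdd_aboveI[of _ "a + b"]) fastforce
  from cSUP_upper[OF assms(3) this] show ?thesis
    using assms by (auto simp: linf_dist_def)
qed

lemma linf_dist_le:
  assumes "0 \<le> c" "\<And>t. t \<in> T \<Longrightarrow> \<bar>f t - g t\<bar> \<le> c"
  shows "linf_dist T f g \<le> c"
  using assms by (auto simp: linf_dist_def intro!: cSUP_least)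

lemma Metric_space_linf: "Metric_space (linf T) (linf_dist T)"
proof
  show nn: "0 \<le> linf_dist T f g" for f g
  proof (cases "T \<noteq> {} \<and> f \<in> linf T \<and> g \<in> linf T")
    case True
    then obtain t where "t \<in> T" by auto
    with True linf_dist_upper[of f T g t] show ?thesis
      by (meson abs_ge_zero order_trans)
  next
    case False
    then show ?thesis by (simp only: linf_dist_def if_False)
  qed
  show "linf_dist T f g = linf_dist T g f" for f g
    by (auto simp: linf_dist_def abs_minus_commute)
  show "linf_dist T f g = 0 \<longleftrightarrow> f = g" if fg: "f \<in> linf T" "g \<in> linf T" for f g
  proof
    assume "linf_dist T f g = 0"
    then have "f t = g t" if "t \<in> T" for t
      using linf_dist_upper[OF fg that] by simp
    then show "f = g"
      using fg by (intro extensionalityI[of f T g]) (auto simp: linf_def)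
  next
    assume "f = g"
    then show "linf_dist T f g = 0"
      using linf_dist_le[of 0 T f g] nn[of f g] by simp
  qed
  show "linf_dist T f k \<le> linf_dist T f g + linf_dist T g k"
    if "f \<in> linf T" "g \<in> linf T" "k \<in> linf T" for f g k
  proof (rule linf_dist_le)
    show "\<bar>f t - k t\<bar> \<le> linf_dist T f g + linf_dist T g k" if "t \<in> T" for t
      using linf_dist_upper[OF \<open>f \<in> linf T\<close> \<open>g \<in> linf T\<close> that]
        linf_dist_upper[OF \<open>g \<in> linf T\<close> \<open>k \<in> linf T\<close> that] by linarith
  qed (simp add: nn)
qed

definition linf_topology :: "'t set \<Rightarrow> ('t \<Rightarrow> real) topology" where
  "linf_topology T = Metric_space.mtopology (linf T) (linf_dist T)"

definition linf_borel :: "'t set \<Rightarrow> ('t \<Rightarrow> real) measure" where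
  "linf_borel T = sigma (linf T) {G. openin (linf_topology T) G}"

text \<open>Weak convergence of the arbitrary maps \<open>Y n\<close> to the Borel map \<open>Z\<close>, which may live on
  another probability space (van der Vaart and Wellner 1996, Definition 1.3.3).\<close>

definition weakly_converges_linf ::
  "'t set \<Rightarrow> 'a measure \<Rightarrow> (nat \<Rightarrow> 'a \<Rightarrow> 't \<Rightarrow> real) \<Rightarrow> 'b measure \<Rightarrow> ('b \<Rightarrow> 't \<Rightarrow> real) \<Rightarrow> bool" where
  "weakly_converges_linf T M Y N Z \<longleftrightarrow>
     (\<forall>n. Y n \<in> space M \<rightarrow> linf T) \<and> Z \<in> N \<rightarrow>\<^sub>M linf_borel T \<and>
     (\<forall>\<phi>. continuous_map (linf_topology T) euclideanreal \<phi> \<and> bounded (\<phi> ` linf T) \<longrightarrow>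
        (\<lambda>n. outer_expectation M (\<lambda>\<omega>. \<phi> (Y n \<omega>))) \<longlonglongrightarrow> (LINT \<omega>|N. \<phi> (Z \<omega>)))"

definition tight_linf :: "'t set \<Rightarrow> 'b measure \<Rightarrow> ('b \<Rightarrow> 't \<Rightarrow> real) \<Rightarrow> bool" where
  "tight_linf T N Z \<longleftrightarrow>
     (\<forall>e>0. \<exists>K. compactin (linf_topology T) K \<and> measure N {\<omega> \<in> space N. Z \<omega> \<in> K} \<ge> 1 - e)"

text \<open>The point mass at 0 counts as a (degenerate) centered normal distribution.\<close>

definition centered_normal :: "'b measure \<Rightarrow> ('b \<Rightarrow> real) \<Rightarrow> bool" where
  "centered_normal N Y \<longleftrightarrow> Y \<in> borel_measurable N \<and>
     ((AE \<omega> in N. Y \<omega> = 0) \<or>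
      (\<exists>\<sigma>>0. distributed N lborel Y (\<lambda>x. ennreal (normal_density 0 \<sigma> x))))"

definition centered_gaussian_process :: "'t set \<Rightarrow> 'b measure \<Rightarrow> ('b \<Rightarrow> 't \<Rightarrow> real) \<Rightarrow> bool" where
  "centered_gaussian_process T N Z \<longleftrightarrow>
     (\<forall>S c. finite S \<and> S \<subseteq> T \<longrightarrow> centered_normal N (\<lambda>\<omega>. \<Sum>t\<in>S. c t * Z \<omega> t))"

section \<open>The time series and its copula\<close>

definition stationary :: "'a measure \<Rightarrow> (int \<Rightarrow> 'a \<Rightarrow> real ^ 'd::finite) \<Rightarrow> bool" where
  "stationary M X \<longleftrightarrow>
     (\<forall>I r. finite I \<longrightarrow>
        distr M (\<Pi>\<^sub>M i\<in>I. borel) (\<lambda>\<omega>. \<lambda>i\<in>I. X (i + r) \<omega>) =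
        distr M (\<Pi>\<^sub>M i\<in>I. borel) (\<lambda>\<omega>. \<lambda>i\<in>I. X i \<omega>))"

text \<open>The order on \<open>real ^ 'd\<close> is the componentwise one, and \<open>{0..1}\<close> is the unit cube.\<close>

definition joint_df :: "'a measure \<Rightarrow> ('a \<Rightarrow> real ^ 'd::finite) \<Rightarrow> real ^ 'd \<Rightarrow> real" where
  "joint_df M Y x = measure M {\<omega> \<in> space M. Y \<omega> \<le> x}"

definition margin_df :: "'a measure \<Rightarrow> ('a \<Rightarrow> real ^ 'd::finite) \<Rightarrow> 'd \<Rightarrow> real \<Rightarrow> real" where
  "margin_df M Y j = cdf (distr M borel (\<lambda>\<omega>. Y \<omega> $ j))"

text \<open>A copula is the restriction to the unit cube of a distribution function with standard uniform
  margins; its values outside the cube are irrelevant.\<close>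

definition is_copula :: "(real ^ 'd::finite \<Rightarrow> real) \<Rightarrow> bool" where
  "is_copula C \<longleftrightarrow>
     (\<exists>Q :: (real ^ 'd) measure. prob_space Q \<and> sets Q = sets borel \<and>
        (\<forall>j. distr Q borel (\<lambda>w. w $ j) = uniform_measure lborel {0..1}) \<and>
        (\<forall>u\<in>{0..1}. C u = measure Q {w. w \<le> u}))"

text \<open>Unique when the margins are continuous (Sklar).\<close>

definition copula_of :: "'a measure \<Rightarrow> ('a \<Rightarrow> real ^ 'd::finite) \<Rightarrow> (real ^ 'd \<Rightarrow> real) \<Rightarrow> bool" where
  "copula_of M Y C \<longleftrightarrow> is_copula C \<and> (\<forall>x. joint_df M Y x = C (\<chi> j. margin_df M Y j (x $ j)))"

definition inner_slab :: "'d \<Rightarrow> (real ^ 'd::finite) set" where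
  "inner_slab j = {u \<in> {0..1}. 0 < u $ j \<and> u $ j < 1}"

definition copula_deriv :: "(real ^ 'd::finite \<Rightarrow> real) \<Rightarrow> 'd \<Rightarrow> real ^ 'd \<Rightarrow> real" where
  "copula_deriv C j u =
     (if u \<in> inner_slab j then deriv (\<lambda>r. C (u + r *\<^sub>R axis j 1)) 0 else 0)"

definition pseudo_obs :: "'a measure \<Rightarrow> (int \<Rightarrow> 'a \<Rightarrow> real ^ 'd::finite) \<Rightarrow> int \<Rightarrow> 'a \<Rightarrow> real ^ 'd" where
  "pseudo_obs M X i \<omega> = (\<chi> j. margin_df M (X i) j (X i \<omega> $ j))"

definition seq_emp_process ::
  "'a measure \<Rightarrow> (int \<Rightarrow> 'a \<Rightarrow> real ^ 'd::finite) \<Rightarrow> (real ^ 'd \<Rightarrow> real) \<Rightarrow> nat \<Rightarrow> 'a \<Rightarrow>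
     real \<Rightarrow> real \<Rightarrow> real ^ 'd \<Rightarrow> real" where
  "seq_emp_process M X C n \<omega> s t u =
     (\<Sum>i = \<lfloor>real n * s\<rfloor> + 1..\<lfloor>real n * t\<rfloor>. of_bool (pseudo_obs M X i \<omega> \<le> u) - C u) / sqrt (real n)"

definition limit_paths :: "(real \<times> (real ^ 'd::finite) \<Rightarrow> real) set" where
  "limit_paths =
     {f. continuous_on ({0..1} \<times> {0..1}) f \<and>
         (\<forall>s\<in>{0..1}. \<forall>u\<in>{0..1}. s = 0 \<or> (\<exists>j. u $ j = 0) \<longrightarrow> f (s, u) = 0) \<and>
         (\<forall>s\<in>{0<..1}. f (s, 1) = 0)}"

section \<open>Empirical copula, smoothing and derivative estimators\<close>

text \<open>
  Here \<open>x :: int \<Rightarrow> real ^ 'd\<close> is a realization of the series. Data sets, the arguments of the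
  bandwidths and of the smoothing laws, are lists, so elements of \<open>(\<real>\<^sup>d)\<^sup>n\<close> are lists of length \<open>n\<close>.
\<close>

definition stretch :: "(int \<Rightarrow> real ^ 'd::finite) \<Rightarrow> int \<Rightarrow> int \<Rightarrow> (real ^ 'd) list" where
  "stretch x k l = map x [k..l]"

definition max_rank :: "(int \<Rightarrow> real ^ 'd::finite) \<Rightarrow> int \<Rightarrow> int \<Rightarrow> int \<Rightarrow> real ^ 'd" where
  "max_rank x k l i = (\<chi> j. \<Sum>t = k..l. of_bool (x t $ j \<le> x i $ j))"

definition emp_copula :: "(int \<Rightarrow> real ^ 'd::finite) \<Rightarrow> int \<Rightarrow> int \<Rightarrow> real ^ 'd \<Rightarrow> real" where
  "emp_copula x k l u =
     (if k \<le> l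
      then (\<Sum>i = k..l. of_bool ((1 / of_int (l - k + 1)) *\<^sub>R max_rank x k l i \<le> u)) / of_int (l - k + 1)
      else 0)"

definition smooth_vec ::
  "((real ^ 'd::finite) list \<Rightarrow> 'd \<Rightarrow> real \<Rightarrow> 'a \<Rightarrow> real) \<Rightarrow> (real ^ 'd) list \<Rightarrow> real ^ 'd \<Rightarrow>
     'a \<Rightarrow> real ^ 'd" where
  "smooth_vec W xs u \<omega> = (\<chi> j. W xs j (u $ j) \<omega>)"

definition smooth_law ::
  "'a measure \<Rightarrow> ((real ^ 'd::finite) list \<Rightarrow> 'd \<Rightarrow> real \<Rightarrow> 'a \<Rightarrow> real) \<Rightarrow>
     (int \<Rightarrow> real ^ 'd) \<Rightarrow> int \<Rightarrow> int \<Rightarrow> real ^ 'd \<Rightarrow> (real ^ 'd) measure" where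
  "smooth_law M W x k l u =
     (if k \<le> l then distr M borel (smooth_vec W (stretch x k l) u) else return borel u)"

text \<open>
  The standing assumption on the smoothing laws: \<open>W xs j (u $ j)\<close> is the \<open>j\<close>-th component of the
  random vector with law \<open>\<nu>\<close>, \<open>\<W> xs u\<close> is the function on the unit cube \<open>[0,1]\<^sup>p\<close> representing this
  vector in terms of the uniform random vector \<open>U\<close>, and the latter is independent of the data.
  Independence is stated with \<open>indep_set\<close> since \<open>indep_var\<close> requires both variables to have the same type.
\<close>

definition smoothing_setup ::
  "'a measure \<Rightarrow> (int \<Rightarrow> 'a \<Rightarrow> real ^ 'd::finite) \<Rightarrow> ('a \<Rightarrow> real ^ 'p::finite) \<Rightarrow>
     ((real ^ 'd) list \<Rightarrow> real ^ 'd \<Rightarrow> real ^ 'p \<Rightarrow> real ^ 'd) \<Rightarrow>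
     ((real ^ 'd) list \<Rightarrow> 'd \<Rightarrow> real \<Rightarrow> 'a \<Rightarrow> real) \<Rightarrow> bool" where
  "smoothing_setup M X U \<W> W \<longleftrightarrow>
     CARD('d) \<le> CARD('p) \<and>
     U \<in> borel_measurable M \<and> (\<forall>\<omega>\<in>space M. U \<omega> \<in> {0..1}) \<and>
     prob_space.indep_vars M (\<lambda>_. borel) (\<lambda>i \<omega>. U \<omega> $ i) UNIV \<and>
     (\<forall>i. distr M borel (\<lambda>\<omega>. U \<omega> $ i) = uniform_measure lborel {0..1}) \<and>
     (\<forall>n::nat. prob_space.indep_set M
        {U -` A \<inter> space M | A. A \<in> sets borel}
        {(\<lambda>\<omega>. \<lambda>i\<in>{1..int n}. X i \<omega>) -` B \<inter> space M | B. B \<in> sets (\<Pi>\<^sub>M i\<in>{1..int n}. borel)}) \<and>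
     (\<forall>xs u. xs \<noteq> [] \<and> u \<in> {0..1} \<longrightarrow>
        \<W> xs u \<in> {0..1} \<rightarrow> {0..1} \<and>
        smooth_vec W xs u \<in> borel_measurable M \<and>
        (\<forall>\<omega>\<in>space M. smooth_vec W xs u \<omega> = \<W> xs u (U \<omega>)) \<and>
        (\<forall>j. prob_space.expectation M (W xs j (u $ j)) = u $ j))"

text \<open>In the following \<open>h\<close> and \<open>h'\<close> are the values of the right and left bandwidths.\<close>

definition copula_increment ::
  "(int \<Rightarrow> real ^ 'd::finite) \<Rightarrow> int \<Rightarrow> int \<Rightarrow> real \<Rightarrow> real \<Rightarrow> 'd \<Rightarrow> real ^ 'd \<Rightarrow> real" where
  "copula_increment x k l h h' j u =
     emp_copula x k l (inf (u + h *\<^sub>R axis j 1) 1) - emp_copula x k l (sup (u - h' *\<^sub>R axis j 1) 0)"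

definition deriv_nabla ::
  "(int \<Rightarrow> real ^ 'd::finite) \<Rightarrow> int \<Rightarrow> int \<Rightarrow> real \<Rightarrow> real \<Rightarrow> 'd \<Rightarrow> real ^ 'd \<Rightarrow> real" where
  "deriv_nabla x k l h h' j u = copula_increment x k l h h' j u / (h + h')"

definition deriv_Delta ::
  "(int \<Rightarrow> real ^ 'd::finite) \<Rightarrow> int \<Rightarrow> int \<Rightarrow> real \<Rightarrow> real \<Rightarrow> 'd \<Rightarrow> real ^ 'd \<Rightarrow> real" where
  "deriv_Delta x k l h h' j u =
     copula_increment x k l h h' j u / (min (u $ j + h) 1 - max (u $ j - h') 0)"

definition trunc01 :: "real \<Rightarrow> real" where
  "trunc01 a = min (max a 0) 1"

definition smooth_deriv_nabla ::
  "'a measure \<Rightarrow> ((real ^ 'd::finite) list \<Rightarrow> 'd \<Rightarrow> real \<Rightarrow> 'a \<Rightarrow> real) \<Rightarrow>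
     ((real ^ 'd) list \<Rightarrow> real) \<Rightarrow> ((real ^ 'd) list \<Rightarrow> real) \<Rightarrow>
     (int \<Rightarrow> real ^ 'd) \<Rightarrow> int \<Rightarrow> int \<Rightarrow> 'd \<Rightarrow> real ^ 'd \<Rightarrow> real" where
  "smooth_deriv_nabla M W h h' x k l j u =
     (LINT w:{0..1}|smooth_law M W x k l u.
        trunc01 (deriv_nabla x k l (h (stretch x k l)) (h' (stretch x k l)) j w))"

definition smooth_deriv_Delta ::
  "'a measure \<Rightarrow> ((real ^ 'd::finite) list \<Rightarrow> 'd \<Rightarrow> real \<Rightarrow> 'a \<Rightarrow> real) \<Rightarrow>
     ((real ^ 'd) list \<Rightarrow> real) \<Rightarrow> ((real ^ 'd) list \<Rightarrow> real) \<Rightarrow>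
     (int \<Rightarrow> real ^ 'd) \<Rightarrow> int \<Rightarrow> int \<Rightarrow> 'd \<Rightarrow> real ^ 'd \<Rightarrow> real" where
  "smooth_deriv_Delta M W h h' x k l j u =
     (LINT w:{0..1}|smooth_law M W x k l u.
        trunc01 (deriv_Delta x k l (h (stretch x k l)) (h' (stretch x k l)) j w))"

text \<open>The supremum over the stretches of the series of length at least about \<open>n * \<delta>\<close>, for an
  estimator \<open>D k l u\<close> and a target \<open>g\<close>.\<close>

definition sup_error ::
  "(int \<Rightarrow> int \<Rightarrow> real ^ 'd::finite \<Rightarrow> real) \<Rightarrow> (real ^ 'd \<Rightarrow> real) \<Rightarrow> 'd \<Rightarrow> nat \<Rightarrow> real \<Rightarrow> real \<Rightarrow> real" where
  "sup_error D g j n \<delta> \<epsilon> =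
     (SUP (s, t)\<in>{(s, t). 0 \<le> s \<and> s \<le> t \<and> t \<le> 1 \<and> \<delta> \<le> t - s}.
        SUP u\<in>{u \<in> {0..1}. \<epsilon> \<le> u $ j \<and> u $ j \<le> 1 - \<epsilon>}.
          \<bar>D (\<lfloor>real n * s\<rfloor> + 1) \<lfloor>real n * t\<rfloor> u - g u\<bar>)"

text \<open>Data sets have length at least 1, so the value at index 0 is irrelevant.\<close>

definition pos_decreasing_to_0 :: "(nat \<Rightarrow> real) \<Rightarrow> bool" where
  "pos_decreasing_to_0 b \<longleftrightarrow>
     (\<forall>n\<ge>1. 0 < b n) \<and> (\<forall>m n. 1 \<le> m \<and> m \<le> n \<longrightarrow> b n \<le> b m) \<and> b \<longlonglongrightarrow> 0"

end

theory Submission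
  imports Defs
begin

text \<open>
  Why the estimators are consistent. The difference quotient of the empirical copula has a window
  of width at least of order \<open>1 / \<surd>m\<close>, where \<open>m\<close> is the length of the stretch, so it must be
  shown that the increment of the empirical copula over the window equals the increment of \<open>C\<close> up to
  \<open>o(1 / \<surd>m)\<close>. This is done pathwise, on an event of probability close to one.

  The event. The weak limit of the sequential empirical process has continuous paths that vanish on
  the lower faces of the cube, and a bounded continuous functional, a truncated oscillation, detects
  how far a bounded function is from this. Hence, for large \<open>n\<close> and outside a measurable event of
  small probability, the process oscillates by less than \<open>\<eta>\<close> over distances at most \<open>\<theta>\<close>
  (\<open>weak_limit_oscillation\<close>, \<open>limit_paths_oscillation\<close>). Everything else is deterministic.

  The empirical copula. Ranks within a stretch depend on the data only through their order, so the
  empirical copula at \<open>u\<close> is, up to ties, the empirical distribution function of the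
  pseudo-observations at the vector \<open>q(u)\<close> of empirical quantiles; and small oscillation forces ties
  to be \<open>o(\<surd>m)\<close> in number (\<open>ties\<close>, \<open>emp_copula_quant\<close>). The two points of a difference quotient
  differ in the coordinate \<open>j\<close> only, and therefore so do the two quantile vectors. A single application
  of the mean value theorem along that coordinate thus reduces the increment of \<open>C \<circ> q\<close> to the
  partial derivative at a point near \<open>u\<close>, where it is uniformly continuous, times the increment of the
  \<open>j\<close>-th quantile function; the latter equals the window up to the oscillation of the \<open>j\<close>-th marginal
  process. Since the other coordinates never move, they may be arbitrarily close to 0 or 1
  (\<open>emp_copula_increment\<close>, \<open>difference_quotient_error\<close>).

  The smoothing. The estimators and the derivative lie in \<open>[0,1]\<close>, so points far from \<open>u\<close> contribute at
  most their mass, which Chebyshev's inequality bounds by the variances of the smoothing law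
  (\<open>smoothing_error\<close>). For points near \<open>u\<close> the window is not cut off by the boundary of the cube, and
  the two versions of the estimator coincide there; \<open>smooth_deriv_outer_prob\<close> treats both at once.
\<close>

section \<open>Oscillations under weak convergence\<close>

text \<open>
  The pairs to be compared are a parameter so that closeness and the boundary condition on the
  limit paths can be tested by one functional.
\<close>

definition oscillation :: "('t \<times> 't) set \<Rightarrow> ('t \<Rightarrow> real) \<Rightarrow> real" where
  "oscillation P f = (SUP (p, q)\<in>P. \<bar>f p - f q\<bar>)"

lemma oscillation_le:
  assumes "P \<noteq> {}" "\<And>p q. (p, q) \<in> P \<Longrightarrow> \<bar>f p - f q\<bar> \<le> c"
  shows "oscillation P f \<le> c"
  unfolding oscillation_def using assms by (intro cSUP_least) auto

lemma oscillation_upper: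
  assumes "f \<in> linf T" "P \<subseteq> T \<times> T" "(p, q) \<in> P"
  shows "\<bar>f p - f q\<bar> \<le> oscillation P f"
proof -
  obtain a where a: "\<forall>t\<in>T. \<bar>f t\<bar> \<le> a"
    using assms by (auto simp: linf_def bounded_iff)
  have "\<bar>f p - f q\<bar> \<le> a + a" if "(p, q) \<in> P" for p q
  proof -
    have "p \<in> T" "q \<in> T" using assms(2) that by auto
    then have "\<bar>f p\<bar> \<le> a" "\<bar>f q\<bar> \<le> a" using a by auto
    then show ?thesis by linarith
  qed
  then have "bdd_above ((\<lambda>(p, q). \<bar>f p - f q\<bar>) ` P)"
    by (intro bdd_aboveI[of _ "a + a"]) auto
  from cSUP_upper[OF assms(3) this] show ?thesis
    by (simp add: oscillation_def)
qed

lemma oscillation_nonneg: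
  assumes "f \<in> linf T" "P \<subseteq> T \<times> T" "P \<noteq> {}"
  shows "0 \<le> oscillation P f"
  using oscillation_upper[OF assms(1,2)] assms(3)
  by (metis abs_ge_zero all_not_in_conv order_trans surj_pair)

lemma oscillation_Lipschitz:
  assumes f: "f \<in> linf T" and g: "g \<in> linf T" and P: "P \<subseteq> T \<times> T" "P \<noteq> {}"
  shows "oscillation P f \<le> oscillation P g + 2 * linf_dist T f g"
proof (rule oscillation_le[OF P(2)])
  fix p q assume pq: "(p, q) \<in> P"
  then have "p \<in> T" "q \<in> T" using P by auto
  from linf_dist_upper[OF f g this(1)] linf_dist_upper[OF f g this(2)]
    oscillation_upper[OF g P(1) pq]
  show "\<bar>f p - f q\<bar> \<le> oscillation P g + 2 * linf_dist T f g" by linarith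
qed

text \<open>
  Weak convergence speaks of bounded functionals only, hence the cap. Reaching the cap means
  oscillating by at least \<open>c\<close>.
\<close>

definition capped_oscillation :: "real \<Rightarrow> ('t \<times> 't) set \<Rightarrow> ('t \<Rightarrow> real) \<Rightarrow> real" where
  "capped_oscillation c P f = min 1 (oscillation P f / c)"

text \<open>
  Holds because the oscillation is Lipschitz for the uniform distance.
\<close>

lemma continuous_map_capped_oscillation:
  assumes P: "P \<subseteq> T \<times> T" "P \<noteq> {}" and c: "0 < c"
  shows "continuous_map (linf_topology T) euclideanreal (capped_oscillation c P)"
proof -
  interpret L: Metric_space "linf T" "linf_dist T" by (rule Metric_space_linf)
  have ab: "\<bar>oscillation P f - oscillation P g\<bar> \<le> 2 * linf_dist T f g"
    if "f \<in> linf T" "g \<in> linf T" for f g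
    using oscillation_Lipschitz[OF that P] oscillation_Lipschitz[OF that(2,1) P]
    by (simp add: L.commute[of f g])
  have "continuous_map L.mtopology euclideanreal (oscillation P)"
    unfolding continuous_map_atin
  proof (rule ballI)
    fix f assume "f \<in> topspace L.mtopology"
    then have f: "f \<in> linf T" by simp
    have ex: "\<exists>\<delta>>0. \<forall>x. x \<in> linf T \<and> 0 < linf_dist T x f \<and> linf_dist T x f < \<delta> \<longrightarrow>
             dist (oscillation P x) (oscillation P f) < e" if "0 < e" for e
    proof (intro exI[of _ "e / 2"] conjI allI impI)
      fix x assume x: "x \<in> linf T \<and> 0 < linf_dist T x f \<and> linf_dist T x f < e / 2"
      then show "dist (oscillation P x) (oscillation P f) < e"
        using ab[of x f] f by (simp add: dist_real_def)
    qed (use that in simp)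
    then show "limitin euclideanreal (oscillation P) (oscillation P f) (atin L.mtopology f)"
      by (auto simp add: limitin_canonical_iff tendsto_iff L.eventually_atin_metric)
  qed
  then show ?thesis
    unfolding capped_oscillation_def linf_topology_def
    using c by (intro continuous_intros) auto
qed

text \<open>
  Markov's inequality for an integrable majorant of \<open>Y\<close>. It yields a measurable exceptional
  event although \<open>Y\<close> need not be measurable.
\<close>

lemma outer_expectation_Markov:
  assumes "prob_space M" and Y0: "\<And>\<omega>. \<omega> \<in> space M \<Longrightarrow> 0 \<le> Y \<omega>" and Y1: "\<And>\<omega>. Y \<omega> \<le> 1"
    and less: "outer_expectation M Y < \<zeta>"
  shows "\<exists>E\<in>sets M. measure M E \<le> \<zeta> \<and> (\<forall>\<omega>\<in>space M - E. Y \<omega> < 1)"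
proof -
  interpret prob_space M by fact
  let ?S = "{integral\<^sup>L M G | G. integrable M G \<and> (\<forall>\<omega>\<in>space M. Y \<omega> \<le> G \<omega>)}"
  have "integrable M (\<lambda>_. 1 :: real)" by simp
  then have "?S \<noteq> {}" using Y1 by blast
  from cInf_lessD[OF this less[unfolded outer_expectation_def]]
  obtain G where G: "integrable M G" "\<forall>\<omega>\<in>space M. Y \<omega> \<le> G \<omega>" and lG: "integral\<^sup>L M G < \<zeta>"
    by auto
  let ?E = "{\<omega> \<in> space M. 1 \<le> G \<omega>}"
  have [measurable]: "G \<in> borel_measurable M" using G by simp
  have G0: "0 \<le> G \<omega>" if "\<omega> \<in> space M" for \<omega> using Y0[OF that] G(2) that by force
  have "measure M ?E \<le> integral\<^sup>L M G / 1"
    by (rule integral_Markov_inequality_measure[where A = "space M"]) (use G G0 in auto)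
  moreover have "?E \<in> sets M" by measurable
  moreover have "\<forall>\<omega>\<in>space M - ?E. Y \<omega> < 1" using G(2) by force
  ultimately show ?thesis using lG by (intro bexI[of _ ?E]) auto
qed

text \<open>
  Asymptotic equicontinuity. Along \<open>i\<close>, the mean capped oscillation of the limit tends to zero by
  dominated convergence; fixing one \<open>i\<close> for which it is below \<open>\<zeta>\<close>, weak convergence carries the
  strict inequality over to the outer expectations of the approximating maps, and Markov's
  inequality turns it into a statement about events.
\<close>

lemma weak_limit_oscillation:
  assumes M: "prob_space M" and N: "prob_space N"
    and wc: "weakly_converges_linf T M Y N Z"
    and P: "\<And>i. P i \<subseteq> T \<times> T" "\<And>i. P i \<noteq> {}"
    and lim: "AE \<omega> in N. (\<lambda>i. oscillation (P i) (Z \<omega>)) \<longlonglongrightarrow> 0"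
    and \<eta>: "0 < \<eta>" and \<zeta>: "0 < \<zeta>"
  shows "\<exists>i. \<forall>\<^sub>F n in sequentially. \<exists>E\<in>sets M. measure M E \<le> \<zeta> \<and>
           (\<forall>\<omega>\<in>space M - E. \<forall>(p, q)\<in>P i. \<bar>Y n \<omega> p - Y n \<omega> q\<bar> < \<eta>)"
proof -
  interpret N: prob_space N by fact
  let ?\<phi> = "\<lambda>i. capped_oscillation \<eta> (P i)"
  have Y: "Y n \<omega> \<in> linf T" if "\<omega> \<in> space M" for n \<omega>
    using wc that by (auto simp: weakly_converges_linf_def)
  have Z[measurable]: "Z \<in> N \<rightarrow>\<^sub>M linf_borel T"
    using wc by (auto simp: weakly_converges_linf_def)
  have sp: "space (linf_borel T) = linf T"
    by (simp add: linf_borel_def space_measure_of_conv)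
  have ZT: "Z \<omega> \<in> linf T" if "\<omega> \<in> space N" for \<omega>
    using measurable_space[OF Z that] by (simp add: sp)
  have bnd: "0 \<le> ?\<phi> i f" "?\<phi> i f \<le> 1" if "f \<in> linf T" for i f
    using oscillation_nonneg[OF that P(1,2)] \<eta> by (auto simp: capped_oscillation_def)
  have cm: "continuous_map (linf_topology T) euclideanreal (?\<phi> i)" for i
    by (rule continuous_map_capped_oscillation[OF P \<eta>])
  have ts: "topspace (linf_topology T) = linf T"
    by (simp add: linf_topology_def Metric_space.topspace_mtopology Metric_space_linf)
  have "?\<phi> i \<in> linf_borel T \<rightarrow>\<^sub>M borel" for i
  proof (rule borel_measurableI)
    fix S :: "real set" assume "open S"
    then have "openin (linf_topology T) {f \<in> linf T. ?\<phi> i f \<in> S}"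
      using cm[of i] by (auto simp: continuous_map_def ts)
    then have "{f \<in> linf T. ?\<phi> i f \<in> S} \<in> sets (linf_borel T)"
      unfolding linf_borel_def using openin_subset[of "linf_topology T"]
      by (subst sets_measure_of) (auto simp: ts)
    then show "?\<phi> i -` S \<inter> space (linf_borel T) \<in> sets (linf_borel T)"
      by (simp add: sp vimage_def Int_def conj_commute)
  qed
  from measurable_compose[OF Z this]
  have meas: "(\<lambda>\<omega>. ?\<phi> i (Z \<omega>)) \<in> borel_measurable N" for i .
  have "(\<lambda>i. LINT \<omega>|N. ?\<phi> i (Z \<omega>)) \<longlonglongrightarrow> (LINT \<omega>|N. 0)"
  proof (rule integral_dominated_convergence[where w = "\<lambda>_. 1"])
    show "AE \<omega> in N. (\<lambda>i. ?\<phi> i (Z \<omega>)) \<longlonglongrightarrow> 0"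
      using lim
    proof eventually_elim
      case (elim \<omega>)
      have "(\<lambda>i. min 1 (oscillation (P i) (Z \<omega>) / \<eta>)) \<longlonglongrightarrow> min 1 (0 / \<eta>)"
        using elim \<eta> by (intro tendsto_min tendsto_intros) auto
      then show ?case by (simp add: capped_oscillation_def)
    qed
    show "AE \<omega> in N. norm (?\<phi> i (Z \<omega>)) \<le> 1" for i
      using bnd[OF ZT] by (intro AE_I2) auto
  qed (use meas in auto)
  then have "\<forall>\<^sub>F i in sequentially. (LINT \<omega>|N. ?\<phi> i (Z \<omega>)) < \<zeta>"
    using \<zeta> by (intro order_tendstoD) auto
  then obtain i where i: "(LINT \<omega>|N. ?\<phi> i (Z \<omega>)) < \<zeta>"
    by (auto dest: eventually_happens)
  have "bounded (?\<phi> i ` linf T)"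
    using bnd by (auto intro!: boundedI[of _ 1])
  with wc cm have "(\<lambda>n. outer_expectation M (\<lambda>\<omega>. ?\<phi> i (Y n \<omega>))) \<longlonglongrightarrow> (LINT \<omega>|N. ?\<phi> i (Z \<omega>))"
    unfolding weakly_converges_linf_def by blast
  from order_tendstoD(2)[OF this i]
  have "\<forall>\<^sub>F n in sequentially. \<exists>E\<in>sets M. measure M E \<le> \<zeta> \<and>
           (\<forall>\<omega>\<in>space M - E. \<forall>(p, q)\<in>P i. \<bar>Y n \<omega> p - Y n \<omega> q\<bar> < \<eta>)"
  proof eventually_elim
    case (elim n)
    have "\<exists>E\<in>sets M. measure M E \<le> \<zeta> \<and> (\<forall>\<omega>\<in>space M - E. ?\<phi> i (Y n \<omega>) < 1)"
      by (rule outer_expectation_Markov[OF M _ _ elim]) (use bnd(1)[OF Y] in \<open>auto simp: capped_oscillation_def\<close>)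
    moreover have "\<bar>Y n \<omega> p - Y n \<omega> q\<bar> < \<eta>"
      if "\<omega> \<in> space M" "?\<phi> i (Y n \<omega>) < 1" "(p, q) \<in> P i" for \<omega> p q
    proof -
      have "oscillation (P i) (Y n \<omega>) < \<eta>"
        using that(2) \<eta> by (simp add: capped_oscillation_def min_def pos_le_divide_eq not_le split: if_splits)
      with oscillation_upper[OF Y[OF that(1), of n] P(1) that(3)] show ?thesis by linarith
    qed
    ultimately show ?case by fast
  qed
  then show ?thesis by blast
qed

text \<open>
  The second kind of pairs encodes that limit paths vanish where a coordinate of \<open>u\<close> is zero: the
  processes vanish at time 0, so a small increment from time 0 is a small value. This is what
  excludes an excess of pseudo-observations equal to zero.
\<close>

definition close_pairs :: "real \<Rightarrow> ((real \<times> (real ^ 'd::finite)) \<times> (real \<times> (real ^ 'd))) set" where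
  "close_pairs \<theta> =
     {(p, q). p \<in> {0..1} \<times> {0..1} \<and> q \<in> {0..1} \<times> {0..1} \<and> dist p q \<le> \<theta>} \<union>
     {((s, u), (0, u)) | s u. s \<in> {0..1} \<and> u \<in> {0..1} \<and> (\<exists>i. u $ i = 0)}"

lemma close_pairs_subset: "close_pairs \<theta> \<subseteq> ({0..1} \<times> {0..1}) \<times> ({0..1} \<times> {0..1})"
  by (auto simp: close_pairs_def)

lemma limit_paths_oscillation:
  fixes f :: "real \<times> (real ^ 'd::finite) \<Rightarrow> real"
  assumes f: "f \<in> limit_paths"
  shows "(\<lambda>i. oscillation (close_pairs (1 / real (Suc i))) f) \<longlonglongrightarrow> 0"
proof -
  let ?T = "{0..1} \<times> {0..1} :: (real \<times> (real ^ 'd)) set"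
  have comp: "compact ?T" by (intro compact_Times) auto
  have "continuous_on ?T f" using f by (auto simp: limit_paths_def)
  then have uc: "uniformly_continuous_on ?T f" using comp by (rule compact_uniformly_continuous)
  have linf: "restrict f ?T \<in> linf ?T"
    using compact_imp_bounded[OF compact_continuous_image[OF \<open>continuous_on ?T f\<close> comp]]
    by (auto simp: linf_def)
  have ne: "((0, 0), (0, 0)) \<in> close_pairs \<theta>" if "0 < \<theta>" for \<theta>
    using that by (auto simp: close_pairs_def less_eq_vec_def)
  have eq: "oscillation (close_pairs \<theta>) f = oscillation (close_pairs \<theta>) (restrict f ?T)" for \<theta>
    unfolding oscillation_def using close_pairs_subset[of \<theta>]
    by (intro SUP_cong) (auto simp: subset_eq split: prod.splits)
  have ne': "close_pairs (1 / real (Suc i)) \<noteq> ({} :: ((real \<times> (real ^ 'd)) \<times> _) set)" for i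
    using ne[of "1 / real (Suc i)"] by (metis empty_iff of_nat_0_less_iff zero_less_Suc zero_less_divide_1_iff)
  have nn: "0 \<le> oscillation (close_pairs (1 / real (Suc i))) f" for i
    unfolding eq by (rule oscillation_nonneg[OF linf close_pairs_subset]) (rule ne')
  show ?thesis
  proof (rule LIMSEQ_I)
    fix r :: real assume "0 < r"
    then obtain d where d: "0 < d" "\<And>p q. p \<in> ?T \<Longrightarrow> q \<in> ?T \<Longrightarrow> dist q p < d \<Longrightarrow> dist (f q) (f p) < r / 2"
      using uc unfolding uniformly_continuous_on_def by (metis half_gt_zero)
    obtain m where m: "1 / real (Suc m) < d"
      using d(1) nat_approx_posE by auto
    have "norm (oscillation (close_pairs (1 / real (Suc i))) f - 0) < r" if "m \<le> i" for i
    proof -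
      have "1 / real (Suc i) \<le> 1 / real (Suc m)" using that by (intro divide_left_mono) auto
      then have i: "1 / real (Suc i) < d" using m by linarith
      have "oscillation (close_pairs (1 / real (Suc i))) f \<le> r / 2"
      proof (rule oscillation_le)
        fix p q :: "real \<times> (real ^ 'd)" assume "(p, q) \<in> close_pairs (1 / real (Suc i))"
        then consider "p \<in> ?T" "q \<in> ?T" "dist p q < d"
          | s u k where "p = (s, u)" "q = (0, u)" "s \<in> {0..1}" "u \<in> {0..1}" "u $ k = 0"
          using i unfolding close_pairs_def by (smt (verit) CollectD Un_iff case_prodD prod.inject)
        then show "\<bar>f p - f q\<bar> \<le> r / 2"
        proof cases
          case 1
          then show ?thesis using d(2)[of q p] by (simp add: dist_real_def dist_commute)
        next
          case 2
          have z: "f (s, u) = 0" if "s \<in> {0..1}" "u \<in> {0..1}" "s = 0 \<or> (\<exists>j. u $ j = 0)" for s u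
            using f that unfolding limit_paths_def by blast
          have "f p = 0" "f q = 0" unfolding 2(1,2) using 2 by (intro z; auto)+
          then show ?thesis using \<open>0 < r\<close> by simp
        qed
      qed (rule ne')
      then show ?thesis using nn[of i] \<open>0 < r\<close> by simp
    qed
    then show "\<exists>no. \<forall>n\<ge>no. norm (oscillation (close_pairs (1 / real (Suc n))) f - 0) < r" by blast
  qed
qed

section \<open>Copulas and their partial derivatives\<close>

lemma borel_measurable_component:
  "f \<in> borel_measurable M \<Longrightarrow> (\<lambda>x. (f x :: real ^ 'd::finite) $ i) \<in> borel_measurable M"
  by (rule measurable_compose[where N = borel]) (auto intro!: borel_measurable_continuous_onI continuous_intros)

text \<open>
  The points at which a distribution function on the cube takes the values of its \<open>j\<close>-th margin.
\<close>

definition marginal_arg :: "'d \<Rightarrow> real \<Rightarrow> real ^ 'd::finite" where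
  "marginal_arg j v = (\<chi> i. if i = j then v else 1)"

lemma marginal_arg_cube: "0 \<le> v \<Longrightarrow> v \<le> 1 \<Longrightarrow> marginal_arg j v \<in> {0..1}"
  by (auto simp: marginal_arg_def less_eq_vec_def)

lemma dist_marginal_arg: "dist (marginal_arg j v) (marginal_arg j w) = \<bar>v - w\<bar>"
proof -
  have "marginal_arg j v - marginal_arg j w = (v - w) *\<^sub>R axis j 1"
    by (auto simp: marginal_arg_def vec_eq_iff axis_def)
  then show ?thesis by (simp add: dist_norm norm_axis_1)
qed

lemma copula_coordinate:
  fixes Q :: "(real ^ 'd::finite) measure"
  assumes "prob_space Q" "sets Q = sets borel"
    and unif: "distr Q borel (\<lambda>w. w $ j) = uniform_measure lborel {0..1}"
    and v: "0 \<le> v" "v \<le> 1"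
  shows "measure Q {w. w $ j \<le> v} = v"
proof -
  have sp: "space Q = UNIV" using sets_eq_imp_space_eq[OF assms(2)] by simp
  have [measurable]: "(\<lambda>w. w $ j) \<in> borel_measurable Q"
    unfolding measurable_cong_sets[OF assms(2) refl] by simp
  have "measure Q {w. w $ j \<le> v} = measure (distr Q borel (\<lambda>w. w $ j)) {..v}"
    by (subst measure_distr) (auto simp: sp vimage_def)
  also have "\<dots> = measure lborel ({0..1} \<inter> {..v}) / measure lborel {0..1 :: real}"
    unfolding unif by (subst measure_uniform_measure) auto
  also have "{0..1} \<inter> {..v} = {0..v}" using v by auto
  finally show ?thesis using v by simp
qed

lemma copula_margin:
  fixes C :: "real ^ 'd::finite \<Rightarrow> real"
  assumes "is_copula C" and v: "0 \<le> v" "v \<le> 1"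
  shows "C (marginal_arg j v) = v"
proof -
  obtain Q where Q: "prob_space Q" "sets Q = sets borel"
    "\<And>j. distr Q borel (\<lambda>w. w $ j) = uniform_measure lborel {0..1}"
    "\<And>u. u \<in> {0..1} \<Longrightarrow> C u = measure Q {w. w \<le> u}"
    using assms(1) unfolding is_copula_def by blast
  interpret prob_space Q by fact
  have sp: "space Q = UNIV" using sets_eq_imp_space_eq[OF Q(2)] by simp
  note coord = copula_coordinate[OF Q(1,2,3)]
  have "AE w in Q. w $ i \<le> 1" for i
    using coord[of 1 i] prob_eq_1[of "{w. w $ i \<le> 1}"] by (simp add: Q(2))
  then have "AE w in Q. \<forall>i\<in>UNIV. w $ i \<le> 1" by (intro AE_finite_allI) auto
  then have ae: "AE w in Q. \<forall>i. w $ i \<le> 1" by simp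
  have "C (marginal_arg j v) = measure Q {w. w \<le> marginal_arg j v}"
    using v by (intro Q marginal_arg_cube)
  also have "\<dots> = measure Q {w. w $ j \<le> v}"
  proof (rule finite_measure_eq_AE)
    show "AE w in Q. w \<in> {w. w \<le> marginal_arg j v} \<longleftrightarrow> w \<in> {w. w $ j \<le> v}"
      using ae by eventually_elim (auto simp: marginal_arg_def less_eq_vec_def)
    have "closed {w :: real ^ 'd. w \<le> marginal_arg j v}"
      using closed_interval_left_cart[of "marginal_arg j v"] by (simp add: less_eq_vec_def)
    then show "{w. w \<le> marginal_arg j v} \<in> sets Q" by (simp add: Q(2))
  qed (simp add: Q(2))
  finally show ?thesis using coord[OF v] by simp
qed

text \<open>
  The mass between the two lower orthants lies in a slab whose mass is the length \<open>r\<close> of an interval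
  under the uniform \<open>j\<close>-th margin.
\<close>

lemma copula_increment_bounds:
  fixes C :: "real ^ 'd::finite \<Rightarrow> real"
  assumes "is_copula C" and u: "u \<in> {0..1}" and r: "0 \<le> r" "u $ j + r \<le> 1"
  shows "0 \<le> C (u + r *\<^sub>R axis j 1) - C u" "C (u + r *\<^sub>R axis j 1) - C u \<le> r"
proof -
  obtain Q where Q: "prob_space Q" "sets Q = sets borel"
    "\<And>j. distr Q borel (\<lambda>w. w $ j) = uniform_measure lborel {0..1}"
    "\<And>u. u \<in> {0..1} \<Longrightarrow> C u = measure Q {w. w \<le> u}"
    using assms(1) unfolding is_copula_def by blast
  interpret prob_space Q by fact
  let ?u = "u + r *\<^sub>R axis j 1"
  note coord = copula_coordinate[OF Q(1,2,3)]
  have u': "?u \<in> {0..1}" and le: "u \<le> ?u" using u r by (auto simp: less_eq_vec_def axis_def)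
  have cl: "closed {w :: real ^ 'd. w \<le> v}" for v :: "real ^ 'd"
    using closed_interval_left_cart[of v] by (simp add: less_eq_vec_def)
  have sub: "{w. w \<le> u} \<subseteq> {w. w \<le> ?u}" using le order_trans by blast
  have m: "{w. w \<le> v} \<in> sets Q" "{w. w $ j \<le> z} \<in> sets Q" for v z
    using cl[of v] by (auto simp: Q(2))
  have d: "C ?u - C u = measure Q ({w. w \<le> ?u} - {w. w \<le> u})"
    using sub by (subst finite_measure_Diff) (simp_all add: Q(4)[OF u] Q(4)[OF u'] m)
  then show "0 \<le> C ?u - C u" by simp
  have "measure Q ({w. w \<le> ?u} - {w. w \<le> u}) \<le> measure Q ({w. w $ j \<le> u $ j + r} - {w. w $ j \<le> u $ j})"
  proof (rule finite_measure_mono)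
    show "{w. w \<le> ?u} - {w. w \<le> u} \<subseteq> {w. w $ j \<le> u $ j + r} - {w. w $ j \<le> u $ j}"
    proof
      fix w assume "w \<in> {w. w \<le> ?u} - {w. w \<le> u}"
      then have w: "\<And>i. w $ i \<le> ?u $ i" "\<not> (\<forall>i. w $ i \<le> u $ i)" by (auto simp: less_eq_vec_def)
      have "w $ i \<le> u $ i" if "i \<noteq> j" for i using w(1)[of i] that by (simp add: axis_def)
      with w(2) have "\<not> w $ j \<le> u $ j" by metis
      with w(1)[of j] show "w \<in> {w. w $ j \<le> u $ j + r} - {w. w $ j \<le> u $ j}" by (simp add: axis_def)
    qed
  qed (intro sets.Diff m)
  also have "\<dots> = (u $ j + r) - u $ j"
    using u r coord[of "u $ j + r" j] coord[of "u $ j" j]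
    by (subst finite_measure_Diff) (auto simp: m less_eq_vec_def)
  finally show "C ?u - C u \<le> r" using d by simp
qed

lemma copula_has_deriv:
  assumes "u \<in> inner_slab j" and "(\<lambda>r. C (u + r *\<^sub>R axis j 1)) differentiable (at 0)"
  shows "((\<lambda>r. C (u + r *\<^sub>R axis j 1)) has_real_derivative copula_deriv C j u) (at 0)"
  using assms by (simp add: copula_deriv_def DERIV_deriv_iff_real_differentiable)

text \<open>
  On the slab the difference quotients lie in \<open>[0,1]\<close>; elsewhere the derivative is zero by
  convention. The bounds matter because they make truncation to \<open>[0,1]\<close> harmless.
\<close>

lemma copula_deriv_bounds:
  assumes "is_copula C"
    and diff: "\<And>u. u \<in> inner_slab j \<Longrightarrow> (\<lambda>r. C (u + r *\<^sub>R axis j 1)) differentiable (at 0)"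
  shows "0 \<le> copula_deriv C j u" "copula_deriv C j u \<le> 1"
proof -
  have "0 \<le> copula_deriv C j u \<and> copula_deriv C j u \<le> 1"
  proof (cases "u \<in> inner_slab j")
    case True
    let ?f = "\<lambda>r. C (u + r *\<^sub>R axis j 1)"
    have "((\<lambda>r. (?f (0 + r) - ?f 0) / r) \<longlongrightarrow> copula_deriv C j u) (at 0)"
      using copula_has_deriv[OF True diff[OF True]] by (simp only: DERIV_def)
    then have lim: "((\<lambda>r. (?f (0 + r) - ?f 0) / r) \<longlongrightarrow> copula_deriv C j u) (at_right 0)"
      by (rule tendsto_mono[rotated]) (simp add: at_le)
    have u: "u \<in> {0..1}" "u $ j < 1" using True by (auto simp: inner_slab_def)
    have "\<forall>\<^sub>F r in at_right 0. r \<in> {0<..<1 - u $ j}"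
      using u(2) by (intro eventually_at_right_real) auto
    then have ev: "\<forall>\<^sub>F r in at_right 0. 0 \<le> (?f (0 + r) - ?f 0) / r \<and> (?f (0 + r) - ?f 0) / r \<le> 1"
    proof eventually_elim
      case (elim r)
      with copula_increment_bounds[OF assms(1) u(1), of r j] show ?case
        by (auto simp: divide_le_eq)
    qed
    show ?thesis
      using tendsto_lowerbound[OF lim] tendsto_upperbound[OF lim] ev
      by (auto simp: eventually_conj_iff trivial_limit_at_right_real)
  next
    case False
    then show ?thesis by (simp add: copula_deriv_def)
  qed
  then show "0 \<le> copula_deriv C j u" "copula_deriv C j u \<le> 1" by auto
qed

text \<open>
  The points with \<open>j\<close>-th coordinate in \<open>[e, 1 - e]\<close> form a compact part of the slab, whatever the
  other coordinates are.
\<close>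

lemma slab_modulus:
  fixes g :: "real ^ 'd::finite \<Rightarrow> real"
  assumes "continuous_on (inner_slab j) g" "0 < e" "0 < \<beta>"
  shows "\<exists>\<rho>>0. \<forall>v\<in>{0..1}. \<forall>w\<in>{0..1}. e \<le> v $ j \<longrightarrow> v $ j \<le> 1 - e \<longrightarrow> e \<le> w $ j \<longrightarrow> w $ j \<le> 1 - e \<longrightarrow>
           dist v w \<le> \<rho> \<longrightarrow> \<bar>g v - g w\<bar> \<le> \<beta>"
proof -
  let ?K = "{0..1} \<inter> {v :: real ^ 'd. e \<le> v $ j \<and> v $ j \<le> 1 - e}"
  have "closed {v :: real ^ 'd. e \<le> v $ j \<and> v $ j \<le> 1 - e}"
    by (intro closed_Collect_conj closed_Collect_le continuous_intros)
  then have "compact ?K" by (intro compact_Int_closed) auto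
  moreover have "?K \<subseteq> inner_slab j" using assms(2) by (auto simp: inner_slab_def)
  then have "continuous_on ?K g" by (rule continuous_on_subset[OF assms(1)])
  ultimately have "uniformly_continuous_on ?K g" by (rule compact_uniformly_continuous[rotated])
  then obtain d where d: "0 < d" "\<And>v w. v \<in> ?K \<Longrightarrow> w \<in> ?K \<Longrightarrow> dist w v < d \<Longrightarrow> dist (g w) (g v) < \<beta>"
    using assms(3) unfolding uniformly_continuous_on_def by blast
  show ?thesis
  proof (intro exI[of _ "d / 2"] conjI ballI impI)
    fix v w :: "real ^ 'd"
    assume "v \<in> {0..1}" "w \<in> {0..1}" "e \<le> v $ j" "v $ j \<le> 1 - e" "e \<le> w $ j" "w $ j \<le> 1 - e" "dist v w \<le> d / 2"
    then have "dist (g v) (g w) < \<beta>" using d(1) by (intro d(2)) auto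
    then show "\<bar>g v - g w\<bar> \<le> \<beta>" by (simp add: dist_real_def)
  qed (use d in simp)
qed

section \<open>Pseudo-observations of a stationary series\<close>

lemma stationary_margin:
  fixes X :: "int \<Rightarrow> 'a \<Rightarrow> real ^ 'd::finite"
  assumes "stationary M X" and X[measurable]: "\<And>i. X i \<in> borel_measurable M"
  shows "margin_df M (X i) j = margin_df M (X 0) j"
proof -
  let ?P = "\<Pi>\<^sub>M i\<in>{0::int}. (borel :: (real ^ 'd) measure)"
  have eq: "distr M ?P (\<lambda>\<omega>. \<lambda>a\<in>{0}. X (a + i) \<omega>) = distr M ?P (\<lambda>\<omega>. \<lambda>a\<in>{0}. X a \<omega>)"
    using assms(1) unfolding stationary_def by blast
  have "distr M borel (\<lambda>\<omega>. X (0 + r) \<omega> $ j) =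
     distr (distr M ?P (\<lambda>\<omega>. \<lambda>a\<in>{0}. X (a + r) \<omega>)) borel (\<lambda>f. f 0 $ j)" for r
    by (subst distr_distr) (auto simp: comp_def intro!: measurable_restrict borel_measurable_component measurable_component_singleton)
  from this[of i] this[of 0] eq show ?thesis by (simp add: margin_df_def)
qed

lemma real_distribution_component:
  assumes "prob_space M" "X \<in> borel_measurable M"
  shows "real_distribution (distr M borel (\<lambda>\<omega>. (X \<omega> :: real ^ 'd::finite) $ j))"
  using prob_space.prob_space_distr[OF assms(1) borel_measurable_component[OF assms(2)]]
  by (simp add: real_distribution_def real_distribution_axioms_def)

lemma pseudo_obs_cube:
  assumes M: "prob_space M" and X: "X i \<in> borel_measurable M"
  shows "pseudo_obs M X i \<omega> \<in> {0..1}"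
proof -
  have "0 \<le> margin_df M (X i) j z \<and> margin_df M (X i) j z \<le> 1" for j z
  proof -
    interpret real_distribution "distr M borel (\<lambda>\<omega>. X i \<omega> $ j)"
      by (rule real_distribution_component[OF assms])
    show ?thesis unfolding margin_df_def using cdf_nonneg cdf_bounded_prob by blast
  qed
  then show ?thesis by (simp add: pseudo_obs_def less_eq_vec_def)
qed

text \<open>
  The order of two observations passes to the pseudo-observations since, by stationarity, both are
  transformed by the same distribution function.
\<close>

lemma pseudo_obs_mono:
  assumes "prob_space M" "stationary M X" and X: "\<And>i. X i \<in> borel_measurable M"
    and le: "X a \<omega> $ j \<le> X b \<omega> $ j"
  shows "pseudo_obs M X a \<omega> $ j \<le> pseudo_obs M X b \<omega> $ j"
proof -
  interpret real_distribution "distr M borel (\<lambda>\<omega>. X 0 \<omega> $ j)"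
    by (rule real_distribution_component[OF assms(1) X])
  have "pseudo_obs M X i \<omega> $ j = margin_df M (X 0) j (X i \<omega> $ j)" for i
    unfolding pseudo_obs_def vec_lambda_beta stationary_margin[OF assms(2) X, of i j] ..
  then show ?thesis using cdf_nondecreasing[OF le] by (simp add: margin_df_def)
qed

section \<open>Empirical copulas of samples with ties\<close>

lemma card_split: "finite A \<Longrightarrow> B \<subseteq> A \<Longrightarrow> real (card A) = real (card B) + real (card (A - B))"
  by (metis card_Diff_subset card_mono finite_subset le_add_diff_inverse of_nat_add)

text \<open>
  The deterministic situation on the good event: \<open>V\<close> is a monotone transform of the data \<open>x\<close>,
  which may have ties, and the unnormalized empirical process of \<open>V\<close> on the stretch from \<open>k\<close> to \<open>l\<close>
  changes by at most \<open>\<kappa>\<close> over distances at most \<open>\<theta>\<close>, is bounded by \<open>K\<close>, and is bounded by \<open>\<kappa>\<close> on the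
  lower faces of the cube. In the application \<open>\<kappa>\<close> is a small and \<open>K\<close> a bounded multiple
  of \<open>\<surd>n\<close>.
\<close>

locale tied_sample =
  fixes x V :: "int \<Rightarrow> real ^ 'd::finite" and k l :: int and C :: "real ^ 'd \<Rightarrow> real"
    and \<theta> \<kappa> K :: real
  assumes kl: "k \<le> l"
    and V_cube: "\<And>i. V i \<in> {0..1}"
    and V_mono: "\<And>a b j. x a $ j \<le> x b $ j \<Longrightarrow> V a $ j \<le> V b $ j"
    and C_margin: "\<And>j v. 0 \<le> v \<Longrightarrow> v \<le> 1 \<Longrightarrow> C (marginal_arg j v) = v"
    and theta_pos: "0 < \<theta>" and kappa_pos: "0 < \<kappa>"
    and dev_close: "\<And>u v. u \<in> {0..1} \<Longrightarrow> v \<in> {0..1} \<Longrightarrow> dist u v \<le> \<theta> \<Longrightarrow>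
          \<bar>(\<Sum>i=k..l. of_bool (V i \<le> u) - C u) - (\<Sum>i=k..l. of_bool (V i \<le> v) - C v)\<bar> \<le> \<kappa>"
    and dev_bound: "\<And>u. u \<in> {0..1} \<Longrightarrow> \<bar>\<Sum>i=k..l. of_bool (V i \<le> u) - C u\<bar> \<le> K"
    and dev_edge: "\<And>u j. u \<in> {0..1} \<Longrightarrow> u $ j = 0 \<Longrightarrow> \<bar>\<Sum>i=k..l. of_bool (V i \<le> u) - C u\<bar> \<le> \<kappa>"
begin

definition m :: real where "m = of_int (l - k + 1)"

definition dev :: "real ^ 'd \<Rightarrow> real" where
  "dev u = (\<Sum>i=k..l. of_bool (V i \<le> u) - C u)"

text \<open>
  The indices counted by the \<open>j\<close>-th condition in the empirical copula at level \<open>c\<close>.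
\<close>

definition low :: "'d \<Rightarrow> real \<Rightarrow> int set" where
  "low j c = {i \<in> {k..l}. max_rank x k l i $ j \<le> m * c}"

text \<open>
  A version of the empirical quantile function of the \<open>j\<close>-th coordinate of \<open>V\<close>, defined from the ranks
  of \<open>x\<close>: the threshold that cuts out \<open>low j c\<close>, up to ties.
\<close>

definition quant :: "'d \<Rightarrow> real \<Rightarrow> real" where
  "quant j c = (if low j c = {} then 0 else Max ((\<lambda>i. V i $ j) ` low j c))"

definition quant_vec :: "real ^ 'd \<Rightarrow> real ^ 'd" where
  "quant_vec u = (\<chi> j. quant j (u $ j))"

lemma finite_between [simp]: "finite {i :: int. k \<le> i \<and> i \<le> l \<and> Q i}"
  by (rule finite_subset[of _ "{k..l}"]) auto

lemma m_pos: "0 < m"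
  using kl by (simp add: m_def)

lemma m_card: "m = card {k..l}"
  using kl by (simp add: m_def)

lemma V_bounds: "0 \<le> V i $ j" "V i $ j \<le> 1"
  using V_cube[of i] by (auto simp: less_eq_vec_def)

lemma abs_le_div_m: "\<bar>m * z\<bar> \<le> b \<Longrightarrow> \<bar>z\<bar> \<le> b / m"
  using m_pos by (simp add: abs_mult pos_le_divide_eq mult.commute)

lemma rank_card: "max_rank x k l i $ j = card {t \<in> {k..l}. x t $ j \<le> x i $ j}"
  by (simp add: max_rank_def sum.If_cases of_bool_def Int_def)

lemma dev_card: "dev u = card {i \<in> {k..l}. V i \<le> u} - m * C u"
  by (simp add: dev_def sum_subtractf m_card sum.If_cases of_bool_def Int_def)

lemma V_le_marginal_arg: "V i \<le> marginal_arg j v \<longleftrightarrow> V i $ j \<le> v"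
  using V_bounds by (auto simp: marginal_arg_def less_eq_vec_def)

lemma dev_margin:
  "0 \<le> v \<Longrightarrow> v \<le> 1 \<Longrightarrow> dev (marginal_arg j v) = card {i \<in> {k..l}. V i $ j \<le> v} - m * v"
  by (simp add: dev_card V_le_marginal_arg C_margin)

text \<open>
  A tie is a jump of the marginal process. It is bounded by the oscillation over an interval so
  short that the drift \<open>m * r\<close> is negligible, or, if there is no room for such an interval above 0, by
  the smallness of the process on the face \<open>u $ j = 0\<close>.
\<close>

lemma ties: "real (card {i \<in> {k..l}. V i $ j = v}) \<le> 3 * \<kappa>"
proof (cases "0 \<le> v \<and> v \<le> 1")
  case False
  then have empty: "{i \<in> {k..l}. V i $ j = v} = {}" using V_bounds by auto
  show ?thesis unfolding empty using kappa_pos by simp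
next
  case True
  \<comment> \<open>Short enough for the oscillation bound, and for a drift of at most \<open>\<kappa>\<close>.\<close>
  define r where "r = min \<theta> (\<kappa> / m)"
  have r: "0 < r" "r \<le> \<theta>" "m * r \<le> \<kappa>"
    using theta_pos kappa_pos m_pos by (auto simp: r_def min_def field_simps)
  show ?thesis
  proof (cases "r \<le> v")
    case rv: True
    have cube: "marginal_arg j v \<in> {0..1}" "marginal_arg j (v - r) \<in> {0..1}"
      using True rv r by (intro marginal_arg_cube; linarith)+
    have "real (card {i \<in> {k..l}. V i $ j = v}) + card {i \<in> {k..l}. V i $ j \<le> v - r} =
          card ({i \<in> {k..l}. V i $ j = v} \<union> {i \<in> {k..l}. V i $ j \<le> v - r})"
      using r by (subst card_Un_disjoint) auto
    also have "\<dots> \<le> card {i \<in> {k..l}. V i $ j \<le> v}"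
      using r by (intro of_nat_mono card_mono) auto
    finally have "card {i \<in> {k..l}. V i $ j = v} \<le>
        dev (marginal_arg j v) - dev (marginal_arg j (v - r)) + m * r"
      using True rv r by (simp add: dev_margin algebra_simps)
    moreover have "\<bar>dev (marginal_arg j v) - dev (marginal_arg j (v - r))\<bar> \<le> \<kappa>"
      unfolding dev_def using r by (intro dev_close[OF cube]) (simp add: dist_marginal_arg)
    ultimately show ?thesis using r kappa_pos by linarith
  next
    case rv: False
    have cube: "marginal_arg j v \<in> {0..1}" "marginal_arg j 0 \<in> {0..1}"
      using True by (intro marginal_arg_cube; linarith)+
    have "real (card {i \<in> {k..l}. V i $ j = v}) \<le> card {i \<in> {k..l}. V i $ j \<le> v}"
      by (intro of_nat_mono card_mono) auto
    also have "\<dots> = dev (marginal_arg j v) + m * v"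
      using True by (simp add: dev_margin)
    finally have "real (card {i \<in> {k..l}. V i $ j = v}) \<le> dev (marginal_arg j v) + m * v" .
    moreover have "\<bar>dev (marginal_arg j v) - dev (marginal_arg j 0)\<bar> \<le> \<kappa>"
      unfolding dev_def using r rv True by (intro dev_close[OF cube]) (simp add: dist_marginal_arg)
    moreover have "\<bar>dev (marginal_arg j 0)\<bar> \<le> \<kappa>"
      unfolding dev_def by (rule dev_edge[OF cube(2), of j]) (simp add: marginal_arg_def)
    moreover have "m * v \<le> m * r" using rv m_pos by (intro mult_left_mono) auto
    ultimately show ?thesis using r by linarith
  qed
qed

lemma low_subset: "low j c \<subseteq> {k..l}" and finite_low: "finite (low j c)"
  by (auto simp: low_def)

lemma rank_mono: "x a $ j \<le> x b $ j \<Longrightarrow> max_rank x k l a $ j \<le> max_rank x k l b $ j"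
  unfolding rank_card by (intro of_nat_mono card_mono) auto

text \<open>
  The maximal element of \<open>low j c\<close> in the order of \<open>x\<close> has a rank of at least the size of this set.
\<close>

lemma card_low_le:
  assumes c: "0 \<le> c"
  shows "card (low j c) \<le> m * c"
proof (cases "low j c = {}")
  case True
  then show ?thesis using m_pos c by simp
next
  case False
  have "\<exists>a\<in>low j c. \<forall>t\<in>low j c. x t $ j \<le> x a $ j"
  proof -
    have "Max ((\<lambda>i. x i $ j) ` low j c) \<in> (\<lambda>i. x i $ j) ` low j c"
      using False finite_low by (intro Max_in) auto
    then obtain a where a: "a \<in> low j c" "x a $ j = Max ((\<lambda>i. x i $ j) ` low j c)" by auto
    have "x t $ j \<le> x a $ j" if "t \<in> low j c" for t
      unfolding a(2) using finite_low that by (intro Max_ge) auto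
    with a(1) show ?thesis by blast
  qed
  then obtain a where a: "a \<in> low j c" "\<forall>t\<in>low j c. x t $ j \<le> x a $ j" by blast
  have "real (card (low j c)) \<le> card {t \<in> {k..l}. x t $ j \<le> x a $ j}"
    using a(2) low_subset[of j c] by (intro of_nat_mono card_mono) auto
  also have "\<dots> \<le> m * c" using a(1) by (simp add: low_def rank_card)
  finally show ?thesis .
qed

text \<open>
  The minimal element outside \<open>low j c\<close> has a rank above \<open>m * c\<close>, and all that its rank counts lies
  in \<open>low j c\<close> or is tied with it.
\<close>

lemma card_low_ge:
  assumes c: "c \<le> 1"
  shows "m * c - 3 * \<kappa> \<le> card (low j c)"
proof (cases "{k..l} - low j c = {}")
  case True
  then have "low j c = {k..l}" using low_subset[of j c] by auto
  then have "real (card (low j c)) = m" by (simp add: m_card)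
  then show ?thesis using kappa_pos mult_left_mono[OF c, of m] m_pos by linarith
next
  case False
  have "\<exists>a\<in>{k..l} - low j c. \<forall>t\<in>{k..l} - low j c. x a $ j \<le> x t $ j"
  proof -
    let ?R = "{k..l} - low j c"
    have "Min ((\<lambda>i. x i $ j) ` ?R) \<in> (\<lambda>i. x i $ j) ` ?R"
      using False by (intro Min_in) auto
    then obtain a where a: "a \<in> ?R" "x a $ j = Min ((\<lambda>i. x i $ j) ` ?R)" by auto
    have "x a $ j \<le> x t $ j" if "t \<in> ?R" for t
      unfolding a(2) using that by (intro Min_le) auto
    with a(1) show ?thesis by blast
  qed
  then obtain a where a: "a \<in> {k..l} - low j c" "\<forall>t\<in>{k..l} - low j c. x a $ j \<le> x t $ j" by blast
  have "m * c \<le> card {t \<in> {k..l}. x t $ j \<le> x a $ j}"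
    using a(1) by (auto simp: low_def rank_card)
  also have "\<dots> \<le> card (low j c \<union> {i \<in> {k..l}. V i $ j = V a $ j})"
  proof (intro of_nat_mono card_mono subsetI)
    fix t assume t: "t \<in> {t \<in> {k..l}. x t $ j \<le> x a $ j}"
    show "t \<in> low j c \<union> {i \<in> {k..l}. V i $ j = V a $ j}"
    proof (cases "t \<in> low j c")
      case False
      then have "x t $ j = x a $ j" using t a(2) by force
      then have "V t $ j = V a $ j" using V_mono[of t j a] V_mono[of a j t] by simp
      then show ?thesis using t by simp
    qed simp
  qed (simp add: finite_low)
  also have "\<dots> \<le> card (low j c) + real (card {i \<in> {k..l}. V i $ j = V a $ j})"
    by (simp only: of_nat_add[symmetric] of_nat_le_iff card_Un_le)
  also have "\<dots> \<le> card (low j c) + 3 * \<kappa>" using ties by simp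
  finally show ?thesis by simp
qed

lemma low_sandwich:
  "low j c \<subseteq> {i \<in> {k..l}. V i $ j \<le> quant j c}"
  "{i \<in> {k..l}. V i $ j < quant j c} \<subseteq> low j c"
proof -
  show "low j c \<subseteq> {i \<in> {k..l}. V i $ j \<le> quant j c}"
    using low_subset[of j c] finite_low[of j c] by (auto simp: quant_def)
  show "{i \<in> {k..l}. V i $ j < quant j c} \<subseteq> low j c"
  proof
    fix i assume i: "i \<in> {i \<in> {k..l}. V i $ j < quant j c}"
    then have ne: "low j c \<noteq> {}" using V_bounds(1)[of i j] by (auto simp: quant_def)
    with finite_low[of j c] have "quant j c \<in> (\<lambda>i. V i $ j) ` low j c"
      using Max_in[of "(\<lambda>i. V i $ j) ` low j c"] by (simp add: quant_def)
    then obtain a where a: "a \<in> low j c" "quant j c = V a $ j" by auto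
    have "x i $ j \<le> x a $ j" using V_mono[of a j i] i a(2) by force
    from rank_mono[OF this] a(1) i show "i \<in> low j c" by (simp add: low_def)
  qed
qed

lemma quant_bounds: "0 \<le> quant j c" "quant j c \<le> 1"
  using V_bounds finite_low[of j c] by (auto simp: quant_def Max_ge_iff)

lemma quant_vec_cube: "quant_vec u \<in> {0..1}"
  using quant_bounds by (auto simp: quant_vec_def less_eq_vec_def)

lemma card_above_low: "real (card ({i \<in> {k..l}. V i $ j \<le> quant j c} - low j c)) \<le> 3 * \<kappa>"
proof -
  have "card ({i \<in> {k..l}. V i $ j \<le> quant j c} - low j c) \<le> card {i \<in> {k..l}. V i $ j = quant j c}"
  proof (rule card_mono)
    show "{i \<in> {k..l}. V i $ j \<le> quant j c} - low j c \<subseteq> {i \<in> {k..l}. V i $ j = quant j c}"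
    proof
      fix i assume i: "i \<in> {i \<in> {k..l}. V i $ j \<le> quant j c} - low j c"
      then have "\<not> V i $ j < quant j c" using low_sandwich(2)[of j c] by blast
      with i show "i \<in> {i \<in> {k..l}. V i $ j = quant j c}" by simp
    qed
  qed simp
  then show ?thesis using ties[of j "quant j c"] by linarith
qed

text \<open>
  Bahadur's representation of a quantile by the empirical process at that quantile, with an error
  of at most the size of a class of tied observations.
\<close>

lemma quant_dev:
  assumes "0 \<le> c" "c \<le> 1"
  shows "\<bar>m * (quant j c - c) + dev (marginal_arg j (quant j c))\<bar> \<le> 3 * \<kappa>"
proof -
  let ?A = "{i \<in> {k..l}. V i $ j \<le> quant j c}"
  have "real (card ?A) = card (low j c) + real (card (?A - low j c))"
    by (rule card_split[OF _ low_sandwich(1)]) simp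
  moreover have "dev (marginal_arg j (quant j c)) = card ?A - m * quant j c"
    by (rule dev_margin[OF quant_bounds])
  ultimately show ?thesis
    using card_low_le[OF assms(1), of j] card_low_ge[OF assms(2), of j] card_above_low[of j c]
    unfolding right_diff_distrib by linarith
qed

lemma quant_close:
  assumes "0 \<le> c" "c \<le> 1"
  shows "\<bar>quant j c - c\<bar> \<le> (3 * \<kappa> + K) / m"
proof -
  have "\<bar>dev (marginal_arg j (quant j c))\<bar> \<le> K"
    unfolding dev_def by (intro dev_bound marginal_arg_cube quant_bounds)
  with quant_dev[OF assms, of j] have "\<bar>m * (quant j c - c)\<bar> \<le> 3 * \<kappa> + K" by linarith
  then show ?thesis by (rule abs_le_div_m)
qed

text \<open>
  In each coordinate the indices in \<open>low\<close> and those with \<open>V\<close> at most the quantile differ by ties only.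
\<close>

lemma emp_copula_quant:
  "\<bar>m * emp_copula x k l u - card {i \<in> {k..l}. V i \<le> quant_vec u}\<bar> \<le> CARD('d) * (3 * \<kappa>)"
proof -
  let ?L = "{i \<in> {k..l}. \<forall>j. i \<in> low j (u $ j)}" and ?Q = "{i \<in> {k..l}. V i \<le> quant_vec u}"
  have eq: "(1 / of_int (l - k + 1)) *\<^sub>R max_rank x k l i \<le> u \<longleftrightarrow> (\<forall>j. i \<in> low j (u $ j))"
    if "i \<in> {k..l}" for i
  proof -
    have "1 / m * y \<le> z \<longleftrightarrow> y \<le> m * z" for y z :: real
      using pos_divide_le_eq[OF m_pos, of y z] by (simp add: mult.commute)
    then show ?thesis using that by (simp only: less_eq_vec_def low_def m_def[symmetric]
      vector_scaleR_component real_scaleR_def mem_Collect_eq simp_thms)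
  qed
  have "(\<Sum>i = k..l. of_bool ((1 / of_int (l - k + 1)) *\<^sub>R max_rank x k l i \<le> u)) =
     (\<Sum>i = k..l. of_bool (\<forall>j. i \<in> low j (u $ j)) :: real)"
    by (rule sum.cong[OF refl]) (simp only: eq)
  also have "\<dots> = card ?L" by (simp add: sum.If_cases of_bool_def Int_def)
  finally have 1: "m * emp_copula x k l u = card ?L"
    using kl m_pos by (simp add: emp_copula_def m_def del: of_int_add of_int_diff)
  have LQ: "?L \<subseteq> ?Q"
    unfolding less_eq_vec_def quant_vec_def using subsetD[OF low_sandwich(1)]
    by (intro Collect_mono conj_mono impI imp_refl) fastforce
  then have 2: "real (card ?Q) = card ?L + real (card (?Q - ?L))"
    by (intro card_split) auto
  have "?Q - ?L \<subseteq> (\<Union>j. {i \<in> {k..l}. V i $ j \<le> quant j (u $ j)} - low j (u $ j))"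
    by (auto simp: less_eq_vec_def quant_vec_def)
  then have "card (?Q - ?L) \<le> card (\<Union>j. {i \<in> {k..l}. V i $ j \<le> quant j (u $ j)} - low j (u $ j))"
    by (intro card_mono) auto
  also have "\<dots> \<le> (\<Sum>j\<in>UNIV. card ({i \<in> {k..l}. V i $ j \<le> quant j (u $ j)} - low j (u $ j)))"
    by (intro card_UN_le) auto
  finally have "real (card (?Q - ?L)) \<le>
      real (\<Sum>j\<in>UNIV. card ({i \<in> {k..l}. V i $ j \<le> quant j (u $ j)} - low j (u $ j)))"
    by (simp only: of_nat_le_iff)
  also have "\<dots> = (\<Sum>j\<in>UNIV. real (card ({i \<in> {k..l}. V i $ j \<le> quant j (u $ j)} - low j (u $ j))))"
    by (rule of_nat_sum)
  also have "\<dots> \<le> CARD('d) * (3 * \<kappa>)"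
    using card_above_low by (intro sum_bounded_above) auto
  finally show ?thesis using 1 2 by simp
qed

lemma emp_copula_expand:
  "\<bar>m * emp_copula x k l u - m * C (quant_vec u) - dev (quant_vec u)\<bar> \<le> CARD('d) * (3 * \<kappa>)"
  using emp_copula_quant[of u] by (simp add: dev_card)

text \<open>
  The quantile vectors at the two end points of the window agree in all coordinates but \<open>j\<close>. The mean
  value theorem in this coordinate gives \<open>g\<close>, the partial derivative of \<open>C\<close>, at an intermediate
  point, times the increment of the \<open>j\<close>-th quantile function. By \<open>quant_dev\<close> the latter differs
  from \<open>h + h'\<close> only by ties and by an increment of the marginal process.
\<close>

lemma emp_copula_increment:
  fixes w :: "real ^ 'd" and j :: 'd and g :: "real ^ 'd \<Rightarrow> real"
  assumes w: "w \<in> {0..1}" "2 * e \<le> w $ j" "w $ j \<le> 1 - 2 * e"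
    and h: "0 \<le> h" "h \<le> e" "0 \<le> h'" "h' \<le> e" and e: "0 < e"
    and \<theta>: "2 * ((3 * \<kappa> + K) / m) + h + h' \<le> \<theta>"
    and e2: "(3 * \<kappa> + K) / m \<le> e / 2"
    and deriv: "\<And>v. v \<in> {0..1} \<Longrightarrow> 0 < v $ j \<Longrightarrow> v $ j < 1 \<Longrightarrow>
          ((\<lambda>r. C (v + r *\<^sub>R axis j 1)) has_real_derivative g v) (at 0)"
    and g01: "\<And>v. v \<in> {0..1} \<Longrightarrow> \<bar>g v\<bar> \<le> 1"
    and g_close: "\<And>v. v \<in> {0..1} \<Longrightarrow> e / 2 \<le> v $ j \<Longrightarrow> v $ j \<le> 1 - e / 2 \<Longrightarrow> dist v w \<le> \<rho> \<Longrightarrow>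
          \<bar>g v - g w\<bar> \<le> \<beta>"
    and \<rho>: "CARD('d) * ((3 * \<kappa> + K) / m + h + h') \<le> \<rho>"
  shows "\<bar>copula_increment x k l h h' j w - g w * (h + h')\<bar> \<le>
           \<beta> * (h + h') + (8 + 6 * CARD('d)) * \<kappa> / m"
proof -
  define a where "a = (3 * \<kappa> + K) / m"
  define q where "q = quant_vec w"
  define q1 where "q1 = quant j (w $ j - h')"
  define q2 where "q2 = quant j (w $ j + h)"
  \<comment> \<open>The line through \<open>quant_vec w\<close> in direction \<open>j\<close>, parametrized by its \<open>j\<close>-th coordinate.\<close>
  let ?p = "\<lambda>r. q + (r - q $ j) *\<^sub>R axis j 1"
  have w01: "0 \<le> w $ i" "w $ i \<le> 1" for i
    using w(1) by (auto simp: less_eq_vec_def)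
  have inf: "inf (w + h *\<^sub>R axis j 1) 1 = w + h *\<^sub>R axis j 1"
    using w h e w01 by (intro inf_absorb1) (auto simp: less_eq_vec_def axis_def)
  have sup: "sup (w - h' *\<^sub>R axis j 1) 0 = w - h' *\<^sub>R axis j 1"
    using w h e w01 by (intro sup_absorb1) (auto simp: less_eq_vec_def axis_def)
  have qv2: "quant_vec (w + h *\<^sub>R axis j 1) = ?p q2"
    by (auto simp: vec_eq_iff quant_vec_def axis_def q_def q2_def)
  have qv1: "quant_vec (w - h' *\<^sub>R axis j 1) = ?p q1"
    by (auto simp: vec_eq_iff quant_vec_def axis_def q_def q1_def)
  have c: "0 \<le> w $ j - h'" "w $ j - h' \<le> 1" "0 \<le> w $ j + h" "w $ j + h \<le> 1"
    using w h e by auto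
  have q1: "\<bar>q1 - (w $ j - h')\<bar> \<le> a" "\<bar>m * (q1 - (w $ j - h')) + dev (marginal_arg j q1)\<bar> \<le> 3 * \<kappa>"
    using quant_close[OF c(1,2)] quant_dev[OF c(1,2)] by (auto simp: q1_def a_def)
  have q2: "\<bar>q2 - (w $ j + h)\<bar> \<le> a" "\<bar>m * (q2 - (w $ j + h)) + dev (marginal_arg j q2)\<bar> \<le> 3 * \<kappa>"
    using quant_close[OF c(3,4)] quant_dev[OF c(3,4)] by (auto simp: q2_def a_def)
  have q12: "0 \<le> q1" "q1 \<le> 1" "0 \<le> q2" "q2 \<le> 1"
    using quant_bounds by (auto simp: q1_def q2_def)
  have close: "\<bar>q2 - q1\<bar> \<le> \<theta>" using q1(1) q2(1) \<theta> h unfolding a_def[symmetric] by linarith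
  have "\<bar>dev (marginal_arg j q2) - dev (marginal_arg j q1)\<bar> \<le> \<kappa>"
    unfolding dev_def using close q12
    by (intro dev_close marginal_arg_cube) (simp_all add: dist_marginal_arg)
  with q1(2) q2(2) have "\<bar>m * (q2 - q1 - (h + h'))\<bar> \<le> 7 * \<kappa>"
    unfolding right_diff_distrib distrib_left by linarith
  then have qinc: "\<bar>q2 - q1 - (h + h')\<bar> \<le> 7 * \<kappa> / m"
    by (rule abs_le_div_m)
  have pcube: "?p r \<in> {0..1}" if "0 \<le> r" "r \<le> 1" for r
    using that quant_vec_cube[of w] by (auto simp: less_eq_vec_def axis_def q_def)
  have dist_p: "dist (?p r) (?p s) = \<bar>r - s\<bar>" for r s
  proof -
    have "?p r - ?p s = (r - s) *\<^sub>R axis j 1" by (simp add: algebra_simps)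
    then show ?thesis by (simp add: dist_norm norm_axis_1)
  qed
  have devp: "\<bar>dev (?p q2) - dev (?p q1)\<bar> \<le> \<kappa>"
    unfolding dev_def using close q12 by (intro dev_close pcube) (simp_all only: dist_p)
  have between: "\<bar>g (?p r) - g w\<bar> \<le> \<beta>" "0 < r" "r < 1" if r: "min q1 q2 \<le> r" "r \<le> max q1 q2" for r
  proof -
    have b: "w $ j - h' - a \<le> r" "r \<le> w $ j + h + a" using r q1(1) q2(1) h by (auto simp: min_def max_def split: if_splits)
    then have r': "e / 2 \<le> r" "r \<le> 1 - e / 2" using w h e2 e unfolding a_def[symmetric] by linarith+
    then show "0 < r" "r < 1" using e by auto
    have "norm (?p r - w) \<le> (\<Sum>i\<in>UNIV. \<bar>(?p r - w) $ i\<bar>)" by (rule norm_le_l1_cart)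
    also have "\<dots> \<le> CARD('d) * (a + h + h')"
    proof (rule sum_bounded_above)
      fix i
      show "\<bar>(?p r - w) $ i\<bar> \<le> a + h + h'"
      proof (cases "i = j")
        case True
        then show ?thesis using b h by (auto simp: axis_def)
      next
        case False
        then show ?thesis using quant_close[OF w01, of i i] h
          by (auto simp: axis_def q_def quant_vec_def a_def)
      qed
    qed
    finally have "dist (?p r) w \<le> \<rho>" using \<rho> by (simp add: dist_norm a_def)
    moreover have "?p r $ j = r" by (simp add: axis_def)
    ultimately show "\<bar>g (?p r) - g w\<bar> \<le> \<beta>" using r' e by (intro g_close pcube) auto
  qed
  have der: "((\<lambda>r. C (?p r)) has_real_derivative g (?p r)) (at r)" if "0 < r" "r < 1" for r
  proof -
    have "((\<lambda>s. C (?p r + s *\<^sub>R axis j 1)) has_real_derivative g (?p r)) (at (r + - r))"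
      using that by (simp, intro deriv pcube) (auto simp: axis_def)
    then have "((\<lambda>s. C (?p r + (s + - r) *\<^sub>R axis j 1)) has_real_derivative g (?p r)) (at r)"
      by (rule DERIV_shift[THEN iffD1])
    moreover have "?p r + (s + - r) *\<^sub>R axis j 1 = ?p s" for s by (simp add: algebra_simps)
    ultimately show ?thesis by (simp only:)
  qed
  \<comment> \<open>The mean value theorem, in a form that does not depend on the order of \<open>q1\<close> and \<open>q2\<close>.\<close>
  have "\<exists>r. min q1 q2 \<le> r \<and> r \<le> max q1 q2 \<and> C (?p q2) - C (?p q1) = g (?p r) * (q2 - q1)"
  proof (cases q1 q2 rule: linorder_cases)
    case less
    have "\<exists>r>q1. r < q2 \<and> C (?p q2) - C (?p q1) = (q2 - q1) * g (?p r)"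
      using less q12 by (intro MVT2 der between(2,3)) auto
    then obtain r where "q1 < r" "r < q2" "C (?p q2) - C (?p q1) = (q2 - q1) * g (?p r)" by blast
    then show ?thesis by (intro exI[of _ r]) auto
  next
    case equal
    then show ?thesis by auto
  next
    case greater
    have "\<exists>r>q2. r < q1 \<and> C (?p q1) - C (?p q2) = (q1 - q2) * g (?p r)"
      using greater q12 by (intro MVT2 der between(2,3)) auto
    then obtain r where "q2 < r" "r < q1" "C (?p q1) - C (?p q2) = (q1 - q2) * g (?p r)" by blast
    then show ?thesis by (intro exI[of _ r]) (auto simp: algebra_simps)
  qed
  then obtain r where r: "min q1 q2 \<le> r" "r \<le> max q1 q2" and
    Cinc: "C (?p q2) - C (?p q1) = g (?p r) * (q2 - q1)" by blast
  note r_bounds = between[OF r]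
  have "C (?p q2) - C (?p q1) - g w * (h + h') =
      (g (?p r) - g w) * (h + h') + g (?p r) * (q2 - q1 - (h + h'))"
    unfolding Cinc by (simp add: algebra_simps)
  also have "\<bar>\<dots>\<bar> \<le> \<bar>g (?p r) - g w\<bar> * (h + h') + \<bar>g (?p r)\<bar> * \<bar>q2 - q1 - (h + h')\<bar>"
    by (rule order_trans[OF abs_triangle_ineq]) (use h in \<open>simp add: abs_mult\<close>)
  also have "\<dots> \<le> \<beta> * (h + h') + 1 * (7 * \<kappa> / m)"
    by (intro add_mono mult_right_mono mult_mono qinc g01 pcube r_bounds(1)) (use r_bounds h in auto)
  finally have Cb: "\<bar>C (?p q2) - C (?p q1) - g w * (h + h')\<bar> \<le> \<beta> * (h + h') + 7 * \<kappa> / m" by simp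
  have "\<bar>m * (copula_increment x k l h h' j w - (C (?p q2) - C (?p q1)))\<bar> \<le> \<kappa> + 2 * (CARD('d) * (3 * \<kappa>))"
    using emp_copula_expand[of "w + h *\<^sub>R axis j 1", unfolded qv2]
      emp_copula_expand[of "w - h' *\<^sub>R axis j 1", unfolded qv1] devp
    unfolding copula_increment_def inf sup right_diff_distrib by linarith
  then have "\<bar>copula_increment x k l h h' j w - (C (?p q2) - C (?p q1))\<bar> \<le> (\<kappa> + 2 * (CARD('d) * (3 * \<kappa>))) / m"
    by (rule abs_le_div_m)
  moreover have "(\<kappa> + 2 * (CARD('d) * (3 * \<kappa>))) / m + 7 * \<kappa> / m = (8 + 6 * CARD('d)) * \<kappa> / m"
    by (subst add_divide_distrib[symmetric]) (simp add: algebra_simps)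
  ultimately show ?thesis using Cb by linarith
qed

end

text \<open>
  Division by the window \<open>r + r'\<close>: the error in \<open>emp_copula_increment\<close> is \<open>\<beta>\<close> times the window plus a
  multiple of \<open>\<kappa> / m\<close>, and the assumption \<open>window\<close> bounds the latter by \<open>\<beta>\<close> times the window as well.
\<close>

lemma (in tied_sample) difference_quotient_error:
  fixes g :: "real ^ 'd \<Rightarrow> real" and w :: "real ^ 'd" and \<tau> :: real
  assumes w: "w \<in> {0..1}" "\<epsilon> / 2 \<le> w $ j" "w $ j \<le> 1 - \<epsilon> / 2" and \<epsilon>: "0 < \<epsilon>"
    and r: "0 < r" "r \<le> \<tau>" "0 < r'" "r' \<le> \<tau>"
    and \<tau>: "\<tau> \<le> \<theta> / 4" "\<tau> \<le> \<epsilon> / 8" "CARD('d) * (3 * \<tau>) \<le> \<rho>"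
    and rate: "(3 * \<kappa> + K) / m \<le> \<tau>"
    and window: "(8 + 6 * CARD('d)) * \<kappa> \<le> \<beta> * (m * (r + r'))"
    and deriv: "\<And>v. v \<in> inner_slab j \<Longrightarrow>
          ((\<lambda>z. C (v + z *\<^sub>R axis j 1)) has_real_derivative g v) (at 0)"
    and g01: "\<And>v. \<bar>g v\<bar> \<le> 1"
    and g_close: "\<And>v. v \<in> {0..1} \<Longrightarrow> \<epsilon> / 8 \<le> v $ j \<Longrightarrow> v $ j \<le> 1 - \<epsilon> / 8 \<Longrightarrow> dist v w \<le> \<rho> \<Longrightarrow>
          \<bar>g v - g w\<bar> \<le> \<beta>"
  shows "\<bar>copula_increment x k l r r' j w / (r + r') - g w\<bar> \<le> 2 * \<beta>"
proof -
  have "\<bar>copula_increment x k l r r' j w - g w * (r + r')\<bar> \<le>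
     \<beta> * (r + r') + (8 + 6 * CARD('d)) * \<kappa> / m"
  proof (rule emp_copula_increment[where e = "\<epsilon> / 4" and \<rho> = \<rho>])
    show "((\<lambda>z. C (v + z *\<^sub>R axis j 1)) has_real_derivative g v) (at 0)"
      if "v \<in> {0..1}" "0 < v $ j" "v $ j < 1" for v
      using that by (intro deriv) (auto simp: inner_slab_def)
    show "\<bar>g v - g w\<bar> \<le> \<beta>"
      if "v \<in> {0..1}" "\<epsilon> / 4 / 2 \<le> v $ j" "v $ j \<le> 1 - \<epsilon> / 4 / 2" "dist v w \<le> \<rho>" for v
      using that by (intro g_close) auto
    have "real CARD('d) * ((3 * \<kappa> + K) / m + r + r') \<le> CARD('d) * (3 * \<tau>)"
      using rate r by (intro mult_left_mono) auto
    with \<tau>(3) show "real CARD('d) * ((3 * \<kappa> + K) / m + r + r') \<le> \<rho>" by linarith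
    show "\<bar>g v\<bar> \<le> 1" for v by (rule g01)
  qed (use w r rate \<tau> \<epsilon> in linarith)+
  also have "\<dots> \<le> \<beta> * (r + r') + \<beta> * (r + r')"
  proof -
    have "(8 + 6 * CARD('d)) * \<kappa> / m \<le> \<beta> * (r + r')"
      using window m_pos by (simp only: pos_divide_le_eq mult.assoc mult.commute[of "r + r'" m])
    then show ?thesis by (rule add_left_mono)
  qed
  finally have "\<bar>copula_increment x k l r r' j w - g w * (r + r')\<bar> / (r + r') \<le> 2 * \<beta>"
    using r by (simp add: divide_le_eq)
  moreover have "copula_increment x k l r r' j w / (r + r') - g w =
      (copula_increment x k l r r' j w - g w * (r + r')) / (r + r')"
    using r by (simp add: field_simps)
  ultimately show ?thesis using r by simp
qed

section \<open>Averaging over the smoothing law\<close>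

text \<open>
  The argument of \<open>emp_copula\<close> is a function \<open>f\<close> in order to cover the clipped shifts in the
  estimators.
\<close>

lemma borel_measurable_emp_copula_shift:
  fixes f :: "real ^ 'd::finite \<Rightarrow> real ^ 'd"
  assumes [measurable]: "\<And>i. (\<lambda>w. f w $ i) \<in> borel_measurable borel"
  shows "(\<lambda>w. emp_copula x k l (f w)) \<in> borel_measurable borel"
  unfolding emp_copula_def less_eq_vec_def of_bool_def by measurable

lemma borel_measurable_copula_increment:
  "(\<lambda>w. copula_increment x k l h h' j w) \<in> borel_measurable borel"
  unfolding copula_increment_def
  by (intro borel_measurable_diff borel_measurable_emp_copula_shift) (simp_all add: inf_vec_def sup_vec_def inf_min sup_max)

lemma borel_measurable_deriv_estimators:
  "(\<lambda>w. trunc01 (deriv_nabla x k l h h' j w)) \<in> borel_measurable borel"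
  "(\<lambda>w. trunc01 (deriv_Delta x k l h h' j w)) \<in> borel_measurable borel"
proof -
  note [measurable] = borel_measurable_copula_increment
  show "(\<lambda>w. trunc01 (deriv_nabla x k l h h' j w)) \<in> borel_measurable borel"
    unfolding trunc01_def deriv_nabla_def by measurable
  show "(\<lambda>w. trunc01 (deriv_Delta x k l h h' j w)) \<in> borel_measurable borel"
    unfolding trunc01_def deriv_Delta_def by measurable
qed

text \<open>
  Pointwise, \<open>|\<phi>(Y) - c|\<close> is at most \<open>\<gamma> + dist Y u ^ 2 / \<rho> ^ 2\<close>, since the second term exceeds 1 where
  \<open>Y\<close> is far from \<open>u\<close>. The expected squared distance is the sum of the variances.
\<close>

lemma smoothing_error:
  fixes Y :: "'a \<Rightarrow> real ^ 'd::finite" and \<phi> :: "real ^ 'd \<Rightarrow> real" and a :: real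
  assumes M: "prob_space M" and Y[measurable]: "Y \<in> borel_measurable M"
    and cube: "\<And>\<omega>. \<omega> \<in> space M \<Longrightarrow> Y \<omega> \<in> {0..1}"
    and mean: "\<And>i. (LINT \<omega>|M. Y \<omega> $ i) = u $ i"
    and var: "\<And>i. prob_space.variance M (\<lambda>\<omega>. Y \<omega> $ i) \<le> a"
    and \<phi>[measurable]: "\<phi> \<in> borel_measurable borel"
    and far: "\<And>w. \<bar>\<phi> w - c\<bar> \<le> 1"
    and near: "\<And>w. w \<in> {0..1} \<Longrightarrow> dist w u \<le> \<rho> \<Longrightarrow> \<bar>\<phi> w - c\<bar> \<le> \<gamma>"
    and \<rho>: "0 < \<rho>" and \<gamma>: "0 \<le> \<gamma>"
  shows "\<bar>(LINT \<omega>|M. \<phi> (Y \<omega>)) - c\<bar> \<le> \<gamma> + CARD('d) * a / \<rho>\<^sup>2"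
proof -
  interpret prob_space M by fact
  have comp[measurable]: "(\<lambda>\<omega>. Y \<omega> $ i) \<in> borel_measurable M" for i by (rule borel_measurable_component) (rule Y)
  have Y01: "0 \<le> Y \<omega> $ i \<and> Y \<omega> $ i \<le> 1" if "\<omega> \<in> space M" for \<omega> i
    using cube[OF that] by (auto simp: less_eq_vec_def)
  have intY: "integrable M (\<lambda>\<omega>. Y \<omega> $ i)" for i
    by (rule integrable_const_bound[where B = 1]) (use Y01 in auto)
  have u01: "0 \<le> u $ i \<and> u $ i \<le> 1" for i
    unfolding mean[symmetric] using Y01
    by (intro conjI Bochner_Integration.integral_nonneg integral_le_const intY AE_I2) auto
  have int2: "integrable M (\<lambda>\<omega>. (Y \<omega> $ i - u $ i)\<^sup>2)" for i
  proof (rule integrable_const_bound[where B = 1])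
    show "AE \<omega> in M. norm ((Y \<omega> $ i - u $ i)\<^sup>2) \<le> 1"
    proof (rule AE_I2)
      fix \<omega> assume "\<omega> \<in> space M"
      then have "\<bar>Y \<omega> $ i - u $ i\<bar> \<le> 1" using Y01[of \<omega> i] u01[of i] by auto
      then show "norm ((Y \<omega> $ i - u $ i)\<^sup>2) \<le> 1" by (simp add: abs_square_le_1)
    qed
  qed measurable
  have bnd: "\<bar>\<phi> (Y \<omega>) - c\<bar> \<le> \<gamma> + (\<Sum>i\<in>UNIV. (Y \<omega> $ i - u $ i)\<^sup>2) / \<rho>\<^sup>2" if "\<omega> \<in> space M" for \<omega>
  proof (cases "dist (Y \<omega>) u \<le> \<rho>")
    case True
    then have "\<bar>\<phi> (Y \<omega>) - c\<bar> \<le> \<gamma>" using cube[OF that] by (intro near)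
    moreover have "0 \<le> (\<Sum>i\<in>UNIV. (Y \<omega> $ i - u $ i)\<^sup>2) / \<rho>\<^sup>2" by (intro divide_nonneg_nonneg sum_nonneg) auto
    ultimately show ?thesis by linarith
  next
    case False
    have "(\<Sum>i\<in>UNIV. (Y \<omega> $ i - u $ i)\<^sup>2) = (dist (Y \<omega>) u)\<^sup>2"
      by (simp add: dist_norm norm_vec_def L2_set_def sum_nonneg)
    moreover have "\<rho>\<^sup>2 \<le> (dist (Y \<omega>) u)\<^sup>2" using False \<rho> by (intro power_mono) auto
    ultimately have "1 \<le> (\<Sum>i\<in>UNIV. (Y \<omega> $ i - u $ i)\<^sup>2) / \<rho>\<^sup>2" using \<rho> by simp
    then show ?thesis using far[of "Y \<omega>"] \<gamma> by linarith
  qed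
  have int\<phi>: "integrable M (\<lambda>\<omega>. \<phi> (Y \<omega>) - c)"
    by (rule integrable_const_bound[where B = 1]) (use far in auto)
  have "integrable M (\<lambda>\<omega>. \<phi> (Y \<omega>))"
  proof (rule integrable_const_bound[where B = "1 + \<bar>c\<bar>"])
    have "\<bar>\<phi> w\<bar> \<le> 1 + \<bar>c\<bar>" for w using far[of w] by linarith
    then show "AE \<omega> in M. norm (\<phi> (Y \<omega>)) \<le> 1 + \<bar>c\<bar>" by simp
  qed measurable
  then have "(LINT \<omega>|M. \<phi> (Y \<omega>)) - c = (LINT \<omega>|M. \<phi> (Y \<omega>) - c)"
    by (simp add: prob_space)
  also have "\<bar>\<dots>\<bar> \<le> (LINT \<omega>|M. \<bar>\<phi> (Y \<omega>) - c\<bar>)" by (rule integral_abs_bound)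
  also have "\<dots> \<le> (LINT \<omega>|M. \<gamma> + (\<Sum>i\<in>UNIV. (Y \<omega> $ i - u $ i)\<^sup>2) / \<rho>\<^sup>2)"
    using bnd int2 int\<phi> by (intro integral_mono) auto
  also have "\<dots> = \<gamma> + (\<Sum>i\<in>UNIV. (LINT \<omega>|M. (Y \<omega> $ i - u $ i)\<^sup>2)) / \<rho>\<^sup>2"
    using int2 by (simp add: prob_space)
  also have "\<dots> \<le> \<gamma> + CARD('d) * a / \<rho>\<^sup>2"
    using var by (intro add_left_mono divide_right_mono sum_bounded_above) (auto simp: mean)
  finally show ?thesis .
qed

lemma smooth_law_integral:
  assumes [measurable]: "smooth_vec W (stretch x k l) u \<in> borel_measurable M" and "k \<le> l"
    and cube: "\<And>\<omega>. \<omega> \<in> space M \<Longrightarrow> smooth_vec W (stretch x k l) u \<omega> \<in> {0..1}"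
    and [measurable]: "\<phi> \<in> borel_measurable borel"
  shows "(LINT w:{0..1}|smooth_law M W x k l u. \<phi> w) = (LINT \<omega>|M. \<phi> (smooth_vec W (stretch x k l) u \<omega>) :: real)"
proof -
  have [measurable]: "{0..1 :: real ^ 'd} \<in> sets borel" by (intro borel_closed) (auto intro: compact_imp_closed)
  have "(LINT w:{0..1}|smooth_law M W x k l u. \<phi> w) =
     (LINT \<omega>|M. indicator {0..1} (smooth_vec W (stretch x k l) u \<omega>) *\<^sub>R \<phi> (smooth_vec W (stretch x k l) u \<omega>))"
    using assms(2) by (simp add: smooth_law_def set_lebesgue_integral_def integral_distr)
  also have "\<dots> = (LINT \<omega>|M. \<phi> (smooth_vec W (stretch x k l) u \<omega>))"
    using cube by (intro Bochner_Integration.integral_cong) (auto simp: indicator_def)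
  finally show ?thesis .
qed

lemma trunc01_diff_le:
  assumes "0 \<le> c" "c \<le> 1"
  shows "\<bar>trunc01 a - c\<bar> \<le> \<bar>a - c\<bar>" "\<bar>trunc01 a - c\<bar> \<le> 1"
  using assms by (auto simp: trunc01_def)

lemma smoothed_error:
  fixes Y :: "'a \<Rightarrow> real ^ 'd::finite" and f g :: "real ^ 'd \<Rightarrow> real" and a :: real
  assumes M: "prob_space M" and Y: "Y \<in> borel_measurable M"
    and cube: "\<And>\<omega>. \<omega> \<in> space M \<Longrightarrow> Y \<omega> \<in> {0..1}"
    and mean: "\<And>i. (LINT \<omega>|M. Y \<omega> $ i) = u $ i"
    and var: "\<And>i. prob_space.variance M (\<lambda>\<omega>. Y \<omega> $ i) \<le> a"
    and meas: "(\<lambda>w. trunc01 (f w)) \<in> borel_measurable borel"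
    and u: "u \<in> {0..1}" "\<epsilon> \<le> u $ j" "u $ j \<le> 1 - \<epsilon>" and \<epsilon>: "0 < \<epsilon>"
    and \<rho>: "0 < \<rho>" and \<beta>: "0 \<le> \<beta>"
    and f_close: "\<And>w. w \<in> {0..1} \<Longrightarrow> \<epsilon> / 2 \<le> w $ j \<Longrightarrow> w $ j \<le> 1 - \<epsilon> / 2 \<Longrightarrow> \<bar>f w - g w\<bar> \<le> 2 * \<beta>"
    and g01: "\<And>v. 0 \<le> g v" "\<And>v. g v \<le> 1"
    and g_close: "\<And>w. w \<in> {0..1} \<Longrightarrow> \<epsilon> / 8 \<le> w $ j \<Longrightarrow> w $ j \<le> 1 - \<epsilon> / 8 \<Longrightarrow> dist w u \<le> \<rho> \<Longrightarrow>
          \<bar>g w - g u\<bar> \<le> \<beta>"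
  shows "\<bar>(LINT \<omega>|M. trunc01 (f (Y \<omega>))) - g u\<bar> \<le> 3 * \<beta> + CARD('d) * a / (min \<rho> (\<epsilon> / 2))\<^sup>2"
proof (rule smoothing_error[OF M Y cube mean var meas])
  show "\<bar>trunc01 (f w) - g u\<bar> \<le> 1" for w by (rule trunc01_diff_le[OF g01])
  show "\<bar>trunc01 (f w) - g u\<bar> \<le> 3 * \<beta>" if w: "w \<in> {0..1}" "dist w u \<le> min \<rho> (\<epsilon> / 2)" for w
  proof -
    have "\<bar>w $ j - u $ j\<bar> \<le> dist w u"
      using component_le_norm_cart[of "w - u" j] by (simp add: dist_norm)
    then have wj: "\<epsilon> / 2 \<le> w $ j" "w $ j \<le> 1 - \<epsilon> / 2" using w(2) u by linarith+
    have "\<bar>g w - g u\<bar> \<le> \<beta>" using w wj \<epsilon> by (intro g_close) auto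
    moreover have "\<bar>trunc01 (f w) - g w\<bar> \<le> 2 * \<beta>"
      using trunc01_diff_le(1)[OF g01, of "f w" w] f_close[OF w(1) wj] by linarith
    ultimately show ?thesis by linarith
  qed
qed (use \<rho> \<epsilon> \<beta> in auto)

section \<open>Uniform consistency over long stretches\<close>

text \<open>
  A function that starts at zero and moves little in short steps is bounded in terms of the
  number of steps.
  For the sequential empirical process, started at time zero, this turns the oscillation bound into
  a uniform bound.
\<close>

lemma abs_le_chain:
  fixes f :: "real \<Rightarrow> real"
  assumes step: "\<And>a b. 0 \<le> a \<Longrightarrow> a \<le> 1 \<Longrightarrow> 0 \<le> b \<Longrightarrow> b \<le> 1 \<Longrightarrow> \<bar>a - b\<bar> \<le> \<theta> \<Longrightarrow> \<bar>f a - f b\<bar> \<le> \<eta>"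
    and f0: "f 0 = 0" and \<theta>: "0 \<le> \<theta>"
  shows "0 \<le> t \<Longrightarrow> t \<le> 1 \<Longrightarrow> t \<le> real N * \<theta> \<Longrightarrow> \<bar>f t\<bar> \<le> real N * \<eta>"
proof (induction N arbitrary: t)
  case 0
  then show ?case by (simp add: f0)
next
  case (Suc N)
  let ?t = "max 0 (t - \<theta>)"
  have "t - \<theta> \<le> real N * \<theta>" using Suc.prems(3) by (simp add: algebra_simps)
  then have "\<bar>f ?t\<bar> \<le> real N * \<eta>" using Suc.prems \<theta> by (intro Suc.IH) auto
  moreover have "\<bar>f t - f ?t\<bar> \<le> \<eta>" using Suc.prems \<theta> by (intro step) auto
  ultimately show ?case by (simp add: algebra_simps)
qed

text \<open>
  The sum over a stretch is the difference of the process at the two times \<open>s\<close> and \<open>t\<close>, which explains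
  the factors 2; \<open>sqrt n\<close> undoes the normalization.
\<close>

lemma tied_sample_of_oscillation:
  fixes X :: "int \<Rightarrow> 'a \<Rightarrow> real ^ 'd::finite"
  assumes M: "prob_space M" and X: "\<And>i. X i \<in> borel_measurable M" and st: "stationary M X"
    and C: "is_copula C" and \<theta>: "0 < \<theta>" and \<eta>: "0 < \<eta>" and N: "1 \<le> real N * \<theta>"
    and osc: "\<And>s u t v. ((s, u), (t, v)) \<in> close_pairs \<theta> \<Longrightarrow>
          \<bar>seq_emp_process M X C n \<omega> 0 s u - seq_emp_process M X C n \<omega> 0 t v\<bar> < \<eta>"
    and s: "0 \<le> s" "s \<le> t" "t \<le> 1" and kl: "\<lfloor>real n * s\<rfloor> + 1 \<le> \<lfloor>real n * t\<rfloor>"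
  shows "tied_sample (\<lambda>i. X i \<omega>) (\<lambda>i. pseudo_obs M X i \<omega>) (\<lfloor>real n * s\<rfloor> + 1) \<lfloor>real n * t\<rfloor> C \<theta>
           (2 * \<eta> * sqrt (real n)) (2 * (real N * \<eta>) * sqrt (real n))"
proof -
  let ?B = "seq_emp_process M X C n \<omega> 0"
  let ?D = "\<lambda>u. \<Sum>i=\<lfloor>real n * s\<rfloor> + 1..\<lfloor>real n * t\<rfloor>. of_bool (pseudo_obs M X i \<omega> \<le> u) - C u"
  have n: "0 < n" using kl by (cases n) auto
  have D: "?D u = sqrt (real n) * (?B t u - ?B s u)" for u
  proof -
    let ?g = "\<lambda>i. of_bool (pseudo_obs M X i \<omega> \<le> u) - C u"
    have z: "0 \<le> \<lfloor>real n * s\<rfloor>" using s by simp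
    have un: "{1..\<lfloor>real n * t\<rfloor>} = {1..\<lfloor>real n * s\<rfloor>} \<union> {\<lfloor>real n * s\<rfloor> + 1..\<lfloor>real n * t\<rfloor>}"
      using z kl by (intro set_eqI iffI; simp only: Un_iff atLeastAtMost_iff; linarith)
    have "sum ?g {1..\<lfloor>real n * t\<rfloor>} = sum ?g {1..\<lfloor>real n * s\<rfloor>} + sum ?g {\<lfloor>real n * s\<rfloor> + 1..\<lfloor>real n * t\<rfloor>}"
      unfolding un by (rule sum.union_disjoint) auto
    then show ?thesis using n by (simp add: seq_emp_process_def field_simps)
  qed
  have half: "\<bar>?D u - ?D v\<bar> \<le> 2 * c * sqrt (real n)"
    if "\<bar>?B t u - ?B t v\<bar> \<le> c" "\<bar>?B s u - ?B s v\<bar> \<le> c" for u v c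
  proof -
    have "?D u - ?D v = sqrt (real n) * ((?B t u - ?B t v) - (?B s u - ?B s v))"
      unfolding D by (simp add: algebra_simps)
    also have "\<bar>\<dots>\<bar> \<le> sqrt (real n) * (2 * c)"
      unfolding abs_mult using that by (intro mult_mono) auto
    finally show ?thesis by (simp add: mult.commute)
  qed
  have whole: "\<bar>?D u\<bar> \<le> 2 * c * sqrt (real n)"
    if "\<bar>?B t u\<bar> \<le> c" "\<bar>?B s u\<bar> \<le> c" for u c
  proof -
    have "\<bar>?D u\<bar> \<le> sqrt (real n) * (2 * c)"
      unfolding D abs_mult using that by (intro mult_mono) auto
    then show ?thesis by (simp add: mult.commute)
  qed
  have B0: "?B 0 u = 0" for u by (simp add: seq_emp_process_def)
  show ?thesis
  proof
    show "pseudo_obs M X i \<omega> \<in> {0..1}" for i by (rule pseudo_obs_cube[OF M X])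
    show "X a \<omega> $ j \<le> X b \<omega> $ j \<Longrightarrow> pseudo_obs M X a \<omega> $ j \<le> pseudo_obs M X b \<omega> $ j" for a b j
      by (rule pseudo_obs_mono[OF M st X])
    show "0 \<le> v \<Longrightarrow> v \<le> 1 \<Longrightarrow> C (marginal_arg j v) = v" for j v by (rule copula_margin[OF C])
    show "0 < 2 * \<eta> * sqrt (real n)" using \<eta> n by simp
  next
    fix u v :: "real ^ 'd" assume uv: "u \<in> {0..1}" "v \<in> {0..1}" "dist u v \<le> \<theta>"
    have "\<bar>?B r u - ?B r v\<bar> \<le> \<eta>" if "0 \<le> r" "r \<le> 1" for r
      using uv that by (intro less_imp_le osc) (simp add: close_pairs_def dist_Pair_Pair)
    then show "\<bar>?D u - ?D v\<bar> \<le> 2 * \<eta> * sqrt (real n)" using s by (intro half) auto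
  next
    fix u :: "real ^ 'd" assume u: "u \<in> {0..1}"
    have "\<bar>?B a u - ?B b u\<bar> \<le> \<eta>" if "0 \<le> a" "a \<le> 1" "0 \<le> b" "b \<le> 1" "\<bar>a - b\<bar> \<le> \<theta>" for a b
      using u that by (intro less_imp_le osc) (simp add: close_pairs_def dist_Pair_Pair dist_real_def)
    from abs_le_chain[of \<theta> "\<lambda>r. ?B r u" \<eta>, OF this B0]
    have "\<bar>?B r u\<bar> \<le> real N * \<eta>" if "0 \<le> r" "r \<le> 1" for r
      using that N \<theta> by simp
    then show "\<bar>?D u\<bar> \<le> 2 * (real N * \<eta>) * sqrt (real n)" using s by (intro whole) auto
  next
    fix u :: "real ^ 'd" and j assume u: "u \<in> {0..1}" "u $ j = 0"
    have "((r, u), (0, u)) \<in> close_pairs \<theta>" if "0 \<le> r" "r \<le> 1" for r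
      using u that unfolding close_pairs_def by auto
    from osc[OF this] have "\<bar>?B r u\<bar> \<le> \<eta>" if "0 \<le> r" "r \<le> 1" for r
      using that by (simp add: B0 less_imp_le)
    then show "\<bar>?D u\<bar> \<le> 2 * \<eta> * sqrt (real n)" using s by (intro whole) auto
  qed (use kl \<theta> in auto)
qed

lemma sup_error_le:
  fixes D :: "int \<Rightarrow> int \<Rightarrow> real ^ 'd::finite \<Rightarrow> real"
  assumes \<delta>: "\<delta> \<le> 1" and \<epsilon>: "0 \<le> \<epsilon>" "\<epsilon> \<le> 1/2"
    and bound: "\<And>s t u. 0 \<le> s \<Longrightarrow> s \<le> t \<Longrightarrow> t \<le> 1 \<Longrightarrow> \<delta> \<le> t - s \<Longrightarrow> u \<in> {0..1} \<Longrightarrow>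
          \<epsilon> \<le> u $ j \<Longrightarrow> u $ j \<le> 1 - \<epsilon> \<Longrightarrow> \<bar>D (\<lfloor>real n * s\<rfloor> + 1) \<lfloor>real n * t\<rfloor> u - g u\<bar> \<le> c"
  shows "\<bar>sup_error D g j n \<delta> \<epsilon>\<bar> \<le> c"
proof -
  let ?U = "{u \<in> {0..1}. \<epsilon> \<le> u $ j \<and> u $ j \<le> 1 - \<epsilon>}"
  have "(\<chi> i. 1/2) \<in> ?U" using \<epsilon> by (auto simp: less_eq_vec_def)
  then have ne: "?U \<noteq> {}" by blast
  have inner: "\<bar>SUP u\<in>?U. \<bar>D (\<lfloor>real n * s\<rfloor> + 1) \<lfloor>real n * t\<rfloor> u - g u\<bar>\<bar> \<le> c"
    if "0 \<le> s" "s \<le> t" "t \<le> 1" "\<delta> \<le> t - s" for s t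
    by (rule cSup_abs_le) (use ne bound[OF that] in auto)
  have "(0, 1) \<in> {(s, t). 0 \<le> s \<and> s \<le> t \<and> t \<le> 1 \<and> \<delta> \<le> t - (s :: real)}" using \<delta> by simp
  then have "{(s, t). 0 \<le> s \<and> s \<le> t \<and> t \<le> 1 \<and> \<delta> \<le> t - (s :: real)} \<noteq> {}" by blast
  then show ?thesis unfolding sup_error_def
    by (intro cSup_abs_le) (use inner in \<open>auto simp only: image_is_empty elim!: imageE\<close>)
qed

lemma tendsto_zero_outer_probI:
  assumes "\<And>\<gamma> \<zeta>. 0 < \<gamma> \<Longrightarrow> 0 < \<zeta> \<Longrightarrow> \<forall>\<^sub>F n in sequentially.
     \<exists>E\<in>sets M. emeasure M E \<le> ennreal \<zeta> \<and> (\<forall>\<omega>\<in>space M - E. \<bar>Y n \<omega>\<bar> \<le> \<gamma>)"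
  shows "tendsto_zero_outer_prob M Y"
  unfolding tendsto_zero_outer_prob_def
proof (intro allI impI order_tendstoI)
  fix \<gamma> :: real and c :: ennreal assume \<gamma>: "0 < \<gamma>" and c: "0 < c"
  obtain \<zeta> where \<zeta>: "0 < \<zeta>" "ennreal \<zeta> < c"
  proof -
    obtain b where b: "0 < b" "b < c" using dense[OF c] by blast
    then obtain r where "b = ennreal r" "0 \<le> r" by (cases b) (auto simp: top.not_eq_extremum)
    with b that show ?thesis by (auto simp: ennreal_less_zero_iff)
  qed
  show "\<forall>\<^sub>F n in sequentially. outer_measure_of M {\<omega> \<in> space M. \<gamma> < \<bar>Y n \<omega>\<bar>} < c"
    using assms[OF \<gamma> \<zeta>(1)]
  proof eventually_elim
    case (elim n)
    then obtain E where E: "E \<in> sets M" "emeasure M E \<le> ennreal \<zeta>" "\<forall>\<omega>\<in>space M - E. \<bar>Y n \<omega>\<bar> \<le> \<gamma>" by blast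
    have "outer_measure_of M {\<omega> \<in> space M. \<gamma> < \<bar>Y n \<omega>\<bar>} \<le> outer_measure_of M E"
      using E(3) by (intro outer_measure_of_mono) (auto simp: not_le[symmetric])
    then show ?case using E \<zeta>(2) by simp
  qed
qed simp

lemma stretch_length:
  assumes "\<delta> \<le> t - s" "2 \<le> real n * \<delta>"
  shows "real n * \<delta> / 2 \<le> of_int (\<lfloor>real n * t\<rfloor> - \<lfloor>real n * s\<rfloor>)"
proof -
  have "real n * \<delta> \<le> real n * t - real n * s"
    using mult_left_mono[OF assms(1), of "real n"] by (simp add: algebra_simps)
  then show ?thesis using assms(2) by linarith
qed

lemma eventually_long_stretch:
  assumes "0 < \<delta>" "\<forall>\<^sub>F m in sequentially. P m"
  shows "\<forall>\<^sub>F n in sequentially. \<forall>m. real n * \<delta> / 2 \<le> real m \<longrightarrow> P m"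
proof -
  obtain m0 where m0: "\<And>m. m0 \<le> m \<Longrightarrow> P m"
    using assms(2) by (auto simp: eventually_sequentially)
  have "\<forall>\<^sub>F n in sequentially. 2 * real m0 / \<delta> \<le> real n"
    using filterlim_real_sequentially by (rule filterlim_at_top[THEN iffD1, rule_format])
  then show ?thesis
  proof eventually_elim
    case (elim n)
    then have "real m0 \<le> real n * \<delta> / 2" using assms(1) by (simp add: field_simps)
    then show ?case using m0 by (meson of_nat_le_iff order_trans)
  qed
qed

text \<open>
  The generic \<open>est\<close> stands for both estimators: where the window fits into \<open>[0,1]\<close> they have the
  same denominator, and elsewhere the truncation to \<open>[0,1]\<close> controls them.
\<close>

lemma smooth_deriv_outer_prob:
  fixes M :: "'a measure"
    and X :: "int \<Rightarrow> 'a \<Rightarrow> real ^ 'd::finite"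
    and C :: "real ^ 'd \<Rightarrow> real"
    and U :: "'a \<Rightarrow> real ^ 'p::finite"
    and est :: "(int \<Rightarrow> real ^ 'd) \<Rightarrow> int \<Rightarrow> int \<Rightarrow> real \<Rightarrow> real \<Rightarrow> 'd \<Rightarrow> real ^ 'd \<Rightarrow> real"
  assumes M: "prob_space M"
    and X: "\<And>i. X i \<in> borel_measurable M"
    and stat: "stationary M X"
    and C: "is_copula C"
    and smooth: "smoothing_setup M X U \<W> W"
    and diff: "\<And>u. u \<in> inner_slab j \<Longrightarrow> (\<lambda>r. C (u + r *\<^sub>R axis j 1)) differentiable (at 0)"
    and cont: "continuous_on (inner_slab j) (copula_deriv C j)"
    and N: "prob_space N"
    and wc: "weakly_converges_linf ({0..1} \<times> {0..1})
         M (\<lambda>n \<omega>. \<lambda>(t, u)\<in>{0..1} \<times> {0..1}. seq_emp_process M X C n \<omega> 0 t u) N Z"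
    and lim: "AE \<omega> in N. Z \<omega> \<in> limit_paths"
    and b: "b \<longlonglongrightarrow> 0" "b' \<longlonglongrightarrow> 0" and L: "0 < L1"
    and bpos: "\<And>n. 1 \<le> n \<Longrightarrow> 0 < b n" "\<And>n. 1 \<le> n \<Longrightarrow> 0 < b' n"
    and bsum: "\<And>n. 1 \<le> n \<Longrightarrow> 1 / sqrt (real n) \<le> b n + b' n"
    and hL: "\<And>xs. xs \<noteq> [] \<Longrightarrow> L1 * b (length xs) \<le> h xs \<and> h xs \<le> L2 * b (length xs)"
    and hL': "\<And>xs. xs \<noteq> [] \<Longrightarrow> L1 * b' (length xs) \<le> h' xs \<and> h' xs \<le> L2 * b' (length xs)"
    and a: "a \<longlonglongrightarrow> 0"
    and var: "\<And>xs u i. xs \<noteq> [] \<Longrightarrow> u \<in> {0..1} \<Longrightarrow> prob_space.variance M (W xs i (u $ i)) \<le> a (length xs)"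
    and \<delta>: "0 < \<delta>" "\<delta> \<le> 1" and \<epsilon>: "0 < \<epsilon>" "\<epsilon> < 1/2"
    and meas: "\<And>x k l r r'. (\<lambda>w. trunc01 (est x k l r r' j w)) \<in> borel_measurable borel"
    and est: "\<And>x k l r r' w. w \<in> {0..1} \<Longrightarrow> 0 < r + r' \<Longrightarrow> 0 \<le> w $ j - r' \<Longrightarrow> w $ j + r \<le> 1 \<Longrightarrow>
          est x k l r r' j w = copula_increment x k l r r' j w / (r + r')"
  shows "tendsto_zero_outer_prob M (\<lambda>n \<omega>. sup_error (\<lambda>k l u.
           LINT w:{0..1}|smooth_law M W (\<lambda>i. X i \<omega>) k l u.
             trunc01 (est (\<lambda>i. X i \<omega>) k l (h (stretch (\<lambda>i. X i \<omega>) k l)) (h' (stretch (\<lambda>i. X i \<omega>) k l)) j w))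
           (copula_deriv C j) j n \<delta> \<epsilon>)"
proof (rule tendsto_zero_outer_probI)
  fix \<gamma> \<zeta> :: real assume \<gamma>: "0 < \<gamma>" and \<zeta>: "0 < \<zeta>"
  let ?T = "{0..1} \<times> {0..1} :: (real \<times> (real ^ 'd)) set"
  let ?g = "copula_deriv C j"
  define d where "d = real CARD('d)"
  have d: "1 \<le> d" by (simp add: d_def Suc_le_eq)
  obtain \<rho> where \<rho>: "0 < \<rho>" and mod: "\<And>v w. v \<in> {0..1} \<Longrightarrow> w \<in> {0..1} \<Longrightarrow> \<epsilon> / 8 \<le> v $ j \<Longrightarrow> v $ j \<le> 1 - \<epsilon> / 8 \<Longrightarrow>
       \<epsilon> / 8 \<le> w $ j \<Longrightarrow> w $ j \<le> 1 - \<epsilon> / 8 \<Longrightarrow> dist v w \<le> \<rho> \<Longrightarrow> \<bar>?g v - ?g w\<bar> \<le> \<gamma> / 4"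
    using slab_modulus[OF cont, of "\<epsilon> / 8" "\<gamma> / 4"] \<epsilon> \<gamma> by auto
  define \<rho>' where "\<rho>' = min \<rho> (\<epsilon> / 2)"
  have \<rho>': "0 < \<rho>'" using \<rho> \<epsilon> by (auto simp: \<rho>'_def)
  \<comment> \<open>With \<open>\<kappa> = 2 * \<eta> * sqrt n\<close>, the error \<open>(8 + 6 d) \<kappa>\<close> is at most \<open>\<gamma> / 4\<close> times \<open>m\<close> times the least possible
    window \<open>L1 / sqrt m\<close>, whenever \<open>m \<ge> n \<delta> / 2\<close>.\<close>
  define \<eta> where "\<eta> = \<gamma> * L1 * sqrt (\<delta> / 2) / (8 * (8 + 6 * d))"
  have \<eta>: "0 < \<eta>" using \<gamma> L \<delta> d by (simp add: \<eta>_def)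
  have \<eta>eq: "(8 + 6 * d) * (2 * \<eta>) = \<gamma> / 4 * (L1 * sqrt (\<delta> / 2))"
    using d by (simp add: \<eta>_def field_simps)
  have "\<exists>i. \<forall>\<^sub>F n in sequentially. \<exists>E\<in>sets M. measure M E \<le> \<zeta> \<and>
      (\<forall>\<omega>\<in>space M - E. \<forall>(p, q)\<in>close_pairs (1 / real (Suc i)).
         \<bar>(\<lambda>(t, u)\<in>?T. seq_emp_process M X C n \<omega> 0 t u) p -
          (\<lambda>(t, u)\<in>?T. seq_emp_process M X C n \<omega> 0 t u) q\<bar> < \<eta>)"
  proof (rule weak_limit_oscillation[OF M N wc close_pairs_subset _ _ \<eta> \<zeta>])
    show "close_pairs (1 / real (Suc i)) \<noteq> ({} :: ((real \<times> (real ^ 'd)) \<times> _) set)" for i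
    proof -
      have "((0, 0), (0, 0)) \<in> (close_pairs (1 / real (Suc i)) :: ((real \<times> (real ^ 'd)) \<times> _) set)"
        by (simp add: close_pairs_def less_eq_vec_def)
      then show ?thesis by blast
    qed
    show "AE \<omega> in N. (\<lambda>i. oscillation (close_pairs (1 / real (Suc i))) (Z \<omega>)) \<longlonglongrightarrow> 0"
      using lim by eventually_elim (rule limit_paths_oscillation)
  qed
  then obtain i0 where ev: "\<forall>\<^sub>F n in sequentially. \<exists>E\<in>sets M. measure M E \<le> \<zeta> \<and>
      (\<forall>\<omega>\<in>space M - E. \<forall>(p, q)\<in>close_pairs (1 / real (Suc i0)).
         \<bar>(\<lambda>(t, u)\<in>?T. seq_emp_process M X C n \<omega> 0 t u) p -
          (\<lambda>(t, u)\<in>?T. seq_emp_process M X C n \<omega> 0 t u) q\<bar> < \<eta>)" by blast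
  define \<theta> where "\<theta> = 1 / real (Suc i0)"
  have \<theta>: "0 < \<theta>" "1 \<le> real (Suc i0) * \<theta>" by (auto simp: \<theta>_def)
  \<comment> \<open>A common bound for both bandwidths and for the distance between quantiles and levels. It keeps
    the window inside the domain of the moduli of continuity of the process and of the derivative.\<close>
  define \<tau> where "\<tau> = min (\<theta> / 4) (min (\<epsilon> / 8) (\<rho> / (3 * d)))"
  have "\<rho> / (3 * d) * (3 * d) = \<rho>" using d by simp
  moreover have "\<tau> * (3 * d) \<le> \<rho> / (3 * d) * (3 * d)"
    using d by (intro mult_right_mono) (auto simp: \<tau>_def)
  ultimately have \<tau>\<rho>: "d * (3 * \<tau>) \<le> \<rho>" by (simp add: mult.commute mult.left_commute)
  have \<tau>: "0 < \<tau>" "\<tau> \<le> \<theta> / 4" "\<tau> \<le> \<epsilon> / 8" using \<theta> \<epsilon> \<rho> d by (auto simp: \<tau>_def)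
  let ?good = "\<lambda>m. 1 \<le> m \<and> L2 * b m \<le> \<tau> \<and> L2 * b' m \<le> \<tau> \<and> d * a m / \<rho>'\<^sup>2 \<le> \<gamma> / 4"
  have lims: "(\<lambda>m. L2 * b m) \<longlonglongrightarrow> L2 * 0" "(\<lambda>m. L2 * b' m) \<longlonglongrightarrow> L2 * 0" "(\<lambda>m. d * a m / \<rho>'\<^sup>2) \<longlonglongrightarrow> d * 0 / \<rho>'\<^sup>2"
    using \<rho>' by (intro tendsto_mult tendsto_divide tendsto_const b a; simp)+
  have "\<forall>\<^sub>F m in sequentially. L2 * b m < \<tau>" "\<forall>\<^sub>F m in sequentially. L2 * b' m < \<tau>"
    "\<forall>\<^sub>F m in sequentially. d * a m / \<rho>'\<^sup>2 < \<gamma> / 4"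
    using \<tau>(1) \<gamma> by (intro order_tendstoD(2)[OF lims(1)] order_tendstoD(2)[OF lims(2)] order_tendstoD(2)[OF lims(3)]; simp)+
  then have "\<forall>\<^sub>F m in sequentially. ?good m"
    using eventually_ge_at_top[of 1] by eventually_elim auto
  from eventually_long_stretch[OF \<delta>(1) this]
  have good: "\<forall>\<^sub>F n in sequentially. \<forall>m. real n * \<delta> / 2 \<le> real m \<longrightarrow> ?good m" .
  \<comment> \<open>\<open>A * sqrt n\<close> is \<open>3 * \<kappa> + K\<close>, so \<open>A * 2 / \<delta> / sqrt n\<close> bounds the distance between quantiles and
    levels.\<close>
  define A where "A = 3 * (2 * \<eta>) + 2 * (real (Suc i0) * \<eta>)"
  have "(\<lambda>n. A * 2 / \<delta> / sqrt (real n)) \<longlonglongrightarrow> 0"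
    by (intro real_tendsto_divide_at_top[OF tendsto_const]
      filterlim_compose[OF sqrt_at_top filterlim_real_sequentially])
  then have small: "\<forall>\<^sub>F n in sequentially. A * 2 / \<delta> / sqrt (real n) < \<tau>"
    using \<tau>(1) by (rule order_tendstoD)
  have large: "\<forall>\<^sub>F n in sequentially. 2 / \<delta> \<le> real n"
    using filterlim_real_sequentially by (rule filterlim_at_top[THEN iffD1, rule_format])
  show "\<forall>\<^sub>F n in sequentially. \<exists>E\<in>sets M. emeasure M E \<le> ennreal \<zeta> \<and> (\<forall>\<omega>\<in>space M - E.
     \<bar>sup_error (\<lambda>k l u. LINT w:{0..1}|smooth_law M W (\<lambda>i. X i \<omega>) k l u.
             trunc01 (est (\<lambda>i. X i \<omega>) k l (h (stretch (\<lambda>i. X i \<omega>) k l)) (h' (stretch (\<lambda>i. X i \<omega>) k l)) j w))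
           (copula_deriv C j) j n \<delta> \<epsilon>\<bar> \<le> \<gamma>)"
    using ev good small large
  proof eventually_elim
    case (elim n)
    interpret prob_space M by fact
    obtain E where E: "E \<in> sets M" "measure M E \<le> \<zeta>" and
      osc: "\<And>\<omega> p q. \<omega> \<in> space M - E \<Longrightarrow> (p, q) \<in> close_pairs \<theta> \<Longrightarrow>
         \<bar>(\<lambda>(t, u)\<in>?T. seq_emp_process M X C n \<omega> 0 t u) p -
          (\<lambda>(t, u)\<in>?T. seq_emp_process M X C n \<omega> 0 t u) q\<bar> < \<eta>"
      using elim(1) unfolding \<theta>_def by blast
    have n\<delta>: "2 \<le> real n * \<delta>" using elim(4) \<delta> by (simp add: field_simps)
    then have n: "0 < real n" using \<delta> by (cases n) auto
    show ?case
    proof (intro bexI[OF _ E(1)] conjI ballI sup_error_le)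
      show "emeasure M E \<le> ennreal \<zeta>"
        using E by (simp add: emeasure_eq_measure ennreal_leI)
    next
      fix \<omega> s t and u :: "real ^ 'd"
      assume \<omega>: "\<omega> \<in> space M - E" and s: "0 \<le> s" "s \<le> t" "t \<le> 1" "\<delta> \<le> t - s"
        and u: "u \<in> {0..1}" "\<epsilon> \<le> u $ j" "u $ j \<le> 1 - \<epsilon>"
      define x where "x = (\<lambda>i. X i \<omega>)"
      define k where "k = \<lfloor>real n * s\<rfloor> + 1"
      define l where "l = \<lfloor>real n * t\<rfloor>"
      define xs where "xs = stretch x k l"
      define len where "len = length xs"
      have long: "real n * \<delta> / 2 \<le> of_int (l - k + 1)"
        using stretch_length[OF s(4) n\<delta>] by (simp add: k_def l_def)
      then have "0 < real_of_int (l - k + 1)" using n\<delta> by linarith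
      then have kl: "k \<le> l" by linarith
      interpret tied_sample x "\<lambda>i. pseudo_obs M X i \<omega>" k l C \<theta>
        "2 * \<eta> * sqrt (real n)" "2 * (real (Suc i0) * \<eta>) * sqrt (real n)"
        unfolding x_def k_def l_def
      proof (rule tied_sample_of_oscillation[OF M X stat C \<theta>(1) \<eta> \<theta>(2) _ s(1-3)])
        fix r r' and v v' :: "real ^ 'd" assume p: "((r, v), (r', v')) \<in> close_pairs \<theta>"
        then have "(r, v) \<in> ?T" "(r', v') \<in> ?T" using close_pairs_subset by blast+
        with osc[OF \<omega> p] show "\<bar>seq_emp_process M X C n \<omega> 0 r v - seq_emp_process M X C n \<omega> 0 r' v'\<bar> < \<eta>"
          by simp
      qed (use kl in \<open>simp add: k_def l_def\<close>)
      have len: "real len = m" using kl by (simp add: len_def xs_def stretch_def m_def)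
      have m\<delta>: "real n * \<delta> / 2 \<le> m" using long by (simp add: m_def)
      have lgood: "?good len" using elim(2) m\<delta> len by simp
      have ne: "xs \<noteq> []" using lgood by (auto simp: len_def)
      define r where "r = h xs"
      define r' where "r' = h' xs"
      have r: "L1 * b len \<le> r" "r \<le> \<tau>" "L1 * b' len \<le> r'" "r' \<le> \<tau>"
        using hL[OF ne] hL'[OF ne] lgood by (auto simp: r_def r'_def len_def)
      have rpos: "0 < r" "0 < r'"
        using r(1,3) bpos[of len] lgood L by (auto intro: less_le_trans[OF mult_pos_pos])
      \<comment> \<open>The lower bound on the window, for the length \<open>m\<close> of the stretch instead of \<open>n\<close>.\<close>
      have "L1 * (1 / sqrt m) \<le> L1 * (b len + b' len)"
        using bsum[of len] lgood L by (intro mult_left_mono) (auto simp: len)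
      also have "\<dots> \<le> r + r'" using r by (simp add: distrib_left)
      finally have "m * (L1 * (1 / sqrt m)) \<le> m * (r + r')"
        using m_pos by (intro mult_left_mono) auto
      moreover have "m * (L1 * (1 / sqrt m)) = L1 * sqrt m"
      proof -
        have "m * (L1 * (1 / sqrt m)) = L1 * (m / sqrt m)" by simp
        then show ?thesis using m_pos by (simp only: real_div_sqrt less_imp_le)
      qed
      moreover have "L1 * (sqrt (\<delta> / 2) * sqrt (real n)) \<le> L1 * sqrt m"
        unfolding real_sqrt_mult[symmetric] using m\<delta> L by (intro mult_left_mono) (auto simp: mult.commute)
      ultimately have mr: "L1 * (sqrt (\<delta> / 2) * sqrt (real n)) \<le> m * (r + r')" by linarith
      have Cerr: "(8 + 6 * d) * (2 * \<eta> * sqrt (real n)) \<le> \<gamma> / 4 * (m * (r + r'))"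
      proof -
        have "(8 + 6 * d) * (2 * \<eta> * sqrt (real n)) = (8 + 6 * d) * (2 * \<eta>) * sqrt (real n)" by simp
        also have "\<dots> = \<gamma> / 4 * (L1 * (sqrt (\<delta> / 2) * sqrt (real n)))"
          unfolding \<eta>eq by simp
        also have "\<dots> \<le> \<gamma> / 4 * (m * (r + r'))" using mr \<gamma> by (intro mult_left_mono) auto
        finally show ?thesis .
      qed
      have \<alpha>: "(3 * (2 * \<eta> * sqrt (real n)) + 2 * (real (Suc i0) * \<eta>) * sqrt (real n)) / m \<le> \<tau>"
      proof -
        have "(3 * (2 * \<eta> * sqrt (real n)) + 2 * (real (Suc i0) * \<eta>) * sqrt (real n)) / m = A * sqrt (real n) / m"
          by (simp add: A_def algebra_simps)
        also have "\<dots> \<le> A * sqrt (real n) / (real n * \<delta> / 2)"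
          using m\<delta> n \<delta> \<eta> m_pos by (intro divide_left_mono mult_pos_pos) (auto simp: A_def)
        also have "\<dots> = A * 2 / \<delta> * (sqrt (real n) / real n)" by (simp add: mult_ac)
        also have "sqrt (real n) / real n = 1 / sqrt (real n)"
          by (simp add: sqrt_divide_self_eq inverse_eq_divide)
        finally show ?thesis using elim(3) by simp
      qed
      have g01: "0 \<le> ?g v" "?g v \<le> 1" for v using copula_deriv_bounds[OF C diff] by auto
      have core: "\<bar>est x k l r r' j w - ?g w\<bar> \<le> 2 * (\<gamma> / 4)"
        if w: "w \<in> {0..1}" "\<epsilon> / 2 \<le> w $ j" "w $ j \<le> 1 - \<epsilon> / 2" for w
      proof -
        have "\<bar>copula_increment x k l r r' j w / (r + r') - ?g w\<bar> \<le> 2 * (\<gamma> / 4)"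
        proof (rule difference_quotient_error[OF w \<epsilon>(1) rpos(1) r(2) rpos(2) r(4) \<tau>(2,3) \<tau>\<rho>[unfolded d_def] \<alpha>])
          show "real (8 + 6 * CARD('d)) * (2 * \<eta> * sqrt (real n)) \<le> \<gamma> / 4 * (m * (r + r'))"
            using Cerr by (simp add: d_def)
          show "\<bar>?g v\<bar> \<le> 1" for v using g01[of v] by simp
          show "\<bar>?g v - ?g w\<bar> \<le> \<gamma> / 4"
            if "v \<in> {0..1}" "\<epsilon> / 8 \<le> v $ j" "v $ j \<le> 1 - \<epsilon> / 8" "dist v w \<le> \<rho>" for v
            using that w \<epsilon> by (intro mod) auto
        qed (intro copula_has_deriv diff)
        moreover have "est x k l r r' j w = copula_increment x k l r r' j w / (r + r')"
          using w r rpos \<tau> \<epsilon> by (intro est) linarith+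
        ultimately show ?thesis by simp
      qed
      let ?Y = "smooth_vec W xs u" and ?\<phi> = "\<lambda>w. trunc01 (est x k l r r' j w)"
      have Y: "?Y \<in> borel_measurable M" "\<And>\<omega>'. \<omega>' \<in> space M \<Longrightarrow> ?Y \<omega>' \<in> {0..1}"
        "\<And>i. expectation (W xs i (u $ i)) = u $ i"
      proof -
        have "\<forall>\<omega>\<in>space M. U \<omega> \<in> {0..1}" and W: "\<W> xs u \<in> {0..1} \<rightarrow> {0..1}"
          "smooth_vec W xs u \<in> borel_measurable M"
          "\<forall>\<omega>\<in>space M. smooth_vec W xs u \<omega> = \<W> xs u (U \<omega>)"
          "\<forall>j. expectation (W xs j (u $ j)) = u $ j"
          using smooth ne u(1) unfolding smoothing_setup_def by blast+
        then show "?Y \<in> borel_measurable M" "\<And>\<omega>'. \<omega>' \<in> space M \<Longrightarrow> ?Y \<omega>' \<in> {0..1}"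
          "\<And>i. expectation (W xs i (u $ i)) = u $ i"
          by (blast, metis PiE, blast)
      qed
      have "\<bar>(LINT \<omega>'|M. ?\<phi> (?Y \<omega>')) - ?g u\<bar> \<le> 3 * (\<gamma> / 4) + CARD('d) * a len / (min \<rho> (\<epsilon> / 2))\<^sup>2"
      proof (rule smoothed_error[OF M Y(1,2) _ _ meas u \<epsilon>(1) \<rho> _ core g01])
        show "expectation (\<lambda>\<omega>'. ?Y \<omega>' $ i) = u $ i" for i
          using Y(3)[of i] by (simp add: smooth_vec_def)
        show "variance (\<lambda>\<omega>'. ?Y \<omega>' $ i) \<le> a len" for i
          using var[OF ne u(1), of i] by (simp add: smooth_vec_def len_def)
        show "\<bar>?g w - ?g u\<bar> \<le> \<gamma> / 4"
          if "w \<in> {0..1}" "\<epsilon> / 8 \<le> w $ j" "w $ j \<le> 1 - \<epsilon> / 8" "dist w u \<le> \<rho>" for w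
          using that u \<epsilon> by (intro mod) auto
      qed (use \<gamma> in auto)
      also have "\<dots> \<le> \<gamma>" using lgood unfolding d_def \<rho>'_def by linarith
      finally have avg: "\<bar>(LINT \<omega>'|M. ?\<phi> (?Y \<omega>')) - ?g u\<bar> \<le> \<gamma>" .
      have law: "(LINT w:{0..1}|smooth_law M W x k l u. ?\<phi> w) = (LINT \<omega>'|M. ?\<phi> (?Y \<omega>'))"
        unfolding xs_def by (rule smooth_law_integral[OF Y(1)[unfolded xs_def] kl Y(2)[unfolded xs_def] meas])
      from avg[folded law] show "\<bar>(LINT w:{0..1}|smooth_law M W (\<lambda>i. X i \<omega>) (\<lfloor>real n * s\<rfloor> + 1) \<lfloor>real n * t\<rfloor> u.
         trunc01 (est (\<lambda>i. X i \<omega>) (\<lfloor>real n * s\<rfloor> + 1) \<lfloor>real n * t\<rfloor>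
           (h (stretch (\<lambda>i. X i \<omega>) (\<lfloor>real n * s\<rfloor> + 1) \<lfloor>real n * t\<rfloor>))
           (h' (stretch (\<lambda>i. X i \<omega>) (\<lfloor>real n * s\<rfloor> + 1) \<lfloor>real n * t\<rfloor>)) j w)) - ?g u\<bar> \<le> \<gamma>"
        unfolding r_def r'_def xs_def x_def k_def l_def .
    qed (use \<delta> \<epsilon> in auto)
  qed
qed

theorem proposition5p9:
  fixes M :: "'a measure"
    and X :: "int \<Rightarrow> 'a \<Rightarrow> real ^ 'd::finite"
    and C :: "real ^ 'd \<Rightarrow> real"
    and U :: "'a \<Rightarrow> real ^ 'p::finite"
    and \<W> :: "(real ^ 'd) list \<Rightarrow> real ^ 'd \<Rightarrow> real ^ 'p \<Rightarrow> real ^ 'd"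
    and W :: "(real ^ 'd) list \<Rightarrow> 'd \<Rightarrow> real \<Rightarrow> 'a \<Rightarrow> real"
    and h h' :: "(real ^ 'd) list \<Rightarrow> real"
    and N :: "'b measure"
    and Z :: "'b \<Rightarrow> real \<times> (real ^ 'd) \<Rightarrow> real"
    and j :: 'd
    and \<delta> \<epsilon> :: real
  assumes "prob_space M"
    and "\<And>i. X i \<in> borel_measurable M"
    and "stationary M X"
    and "\<And>j. continuous_on UNIV (margin_df M (X 0) j)"
    and "copula_of M (X 0) C"
    and "smoothing_setup M X U \<W> W"
    and "\<And>xs. xs \<noteq> [] \<Longrightarrow> h xs \<in> {0..1/2} \<and> h' xs \<in> {0..1/2}"
    and "\<And>k l. 1 \<le> k \<Longrightarrow> k \<le> l \<Longrightarrow>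
           (\<lambda>\<omega>. h (stretch (\<lambda>i. X i \<omega>) k l)) \<in> borel_measurable M \<and>
           (\<lambda>\<omega>. h' (stretch (\<lambda>i. X i \<omega>) k l)) \<in> borel_measurable M \<and>
           (\<forall>\<omega>\<in>space M. h (stretch (\<lambda>i. X i \<omega>) k l) + h' (stretch (\<lambda>i. X i \<omega>) k l) > 0)"
    and i: "\<And>j. (\<forall>u\<in>inner_slab j. (\<lambda>r. C (u + r *\<^sub>R axis j 1)) differentiable (at 0)) \<and>
           continuous_on (inner_slab j) (copula_deriv C j)"
    and ii: "prob_space N"
      "weakly_converges_linf ({0..1} \<times> {0..1})
         M (\<lambda>n \<omega>. \<lambda>(t, u)\<in>{0..1} \<times> {0..1}. seq_emp_process M X C n \<omega> 0 t u) N Z"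
      "tight_linf ({0..1} \<times> {0..1}) N Z"
      "centered_gaussian_process ({0..1} \<times> {0..1}) N Z"
      "AE \<omega> in N. Z \<omega> \<in> limit_paths"
    and iii: "\<exists>b b' L1 L2. pos_decreasing_to_0 b \<and> pos_decreasing_to_0 b' \<and> 0 < L1 \<and> L1 \<le> L2 \<and>
           (\<forall>n\<ge>1. b n + b' n \<ge> 1 / sqrt (real n) \<and>
              (\<forall>xs. length xs = n \<longrightarrow>
                 L1 * b n \<le> h xs \<and> h xs \<le> min (L2 * b n) (1/2) \<and>
                 L1 * b' n \<le> h' xs \<and> h' xs \<le> min (L2 * b' n) (1/2)))"
    and iv: "\<exists>a. pos_decreasing_to_0 a \<and>
           (\<forall>n\<ge>1. \<forall>xs. length xs = n \<longrightarrow>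
              (\<forall>u\<in>{0..1}. \<forall>j. prob_space.variance M (W xs j (u $ j)) \<le> a n))"
    and "0 < \<delta>" "\<delta> < 1" "0 < \<epsilon>" "\<epsilon> < 1/2"
  shows "tendsto_zero_outer_prob M (\<lambda>n \<omega>.
           sup_error (\<lambda>k l. smooth_deriv_Delta M W h h' (\<lambda>i. X i \<omega>) k l j) (copula_deriv C j) j n \<delta> \<epsilon>) \<and>
         tendsto_zero_outer_prob M (\<lambda>n \<omega>.
           sup_error (\<lambda>k l. smooth_deriv_nabla M W h h' (\<lambda>i. X i \<omega>) k l j) (copula_deriv C j) j n \<delta> \<epsilon>)"
proof -
  have cop: "is_copula C" using \<open>copula_of M (X 0) C\<close> by (simp add: copula_of_def)
  obtain b b' L1 L2 where b: "pos_decreasing_to_0 b" "pos_decreasing_to_0 b'" and L: "0 < L1" "L1 \<le> L2"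
    and band: "\<And>n xs. 1 \<le> n \<Longrightarrow> length xs = n \<Longrightarrow> b n + b' n \<ge> 1 / sqrt (real n) \<and>
      L1 * b n \<le> h xs \<and> h xs \<le> min (L2 * b n) (1/2) \<and> L1 * b' n \<le> h' xs \<and> h' xs \<le> min (L2 * b' n) (1/2)"
  proof -
    from iii obtain b b' L1 L2 where *: "pos_decreasing_to_0 b" "pos_decreasing_to_0 b'" "0 < L1" "L1 \<le> L2"
      "\<forall>n\<ge>1. b n + b' n \<ge> 1 / sqrt (real n) \<and>
         (\<forall>xs. length xs = n \<longrightarrow>
            L1 * b n \<le> h xs \<and> h xs \<le> min (L2 * b n) (1/2) \<and>
            L1 * b' n \<le> h' xs \<and> h' xs \<le> min (L2 * b' n) (1/2))"
      by (elim exE conjE)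
    show ?thesis by (rule that[OF *(1-4)]) (use *(5) in simp)
  qed
  obtain a where a: "pos_decreasing_to_0 a"
    and var: "\<And>n xs u i. 1 \<le> n \<Longrightarrow> length xs = n \<Longrightarrow> u \<in> {0..1} \<Longrightarrow>
      prob_space.variance M (W xs i (u $ i)) \<le> a n"
  proof -
    from iv obtain a where *: "pos_decreasing_to_0 a"
      "\<forall>n\<ge>1. \<forall>xs. length xs = n \<longrightarrow> (\<forall>u\<in>{0..1}. \<forall>j. prob_space.variance M (W xs j (u $ j)) \<le> a n)"
      by (elim exE conjE)
    show ?thesis by (rule that[OF *(1)]) (use *(2) in simp)
  qed
  have len: "1 \<le> length xs" if "xs \<noteq> []" for xs :: "(real ^ 'd) list"
    using that by (simp add: Suc_le_eq)
  have bsum: "1 / sqrt (real n) \<le> b n + b' n" if "1 \<le> n" for n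
    using band[OF that, of "replicate n 0"] by simp
  have hL: "L1 * b (length xs) \<le> h xs \<and> h xs \<le> L2 * b (length xs)"
    "L1 * b' (length xs) \<le> h' xs \<and> h' xs \<le> L2 * b' (length xs)" if "xs \<noteq> []" for xs
    using band[OF len[OF that] refl] by auto
  have var': "prob_space.variance M (W xs i (u $ i)) \<le> a (length xs)"
    if "xs \<noteq> []" "u \<in> {0..1}" for xs u i
    using var[OF len[OF that(1)] refl that(2)] .
  have pos: "0 < b n" "0 < b' n" if "1 \<le> n" for n
    using b that by (auto simp: pos_decreasing_to_0_def)
  have lim: "b \<longlonglongrightarrow> 0" "b' \<longlonglongrightarrow> 0" "a \<longlonglongrightarrow> 0"
    using b a by (auto simp: pos_decreasing_to_0_def)
  have diff: "(\<lambda>r. C (u + r *\<^sub>R axis j 1)) differentiable (at 0)" if "u \<in> inner_slab j" for u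
    using i[of j] that by blast
  have cont: "continuous_on (inner_slab j) (copula_deriv C j)" using i[of j] by blast
  have conv: "tendsto_zero_outer_prob M (\<lambda>n \<omega>. sup_error (\<lambda>k l u.
        LINT w:{0..1}|smooth_law M W (\<lambda>i. X i \<omega>) k l u.
          trunc01 (est (\<lambda>i. X i \<omega>) k l (h (stretch (\<lambda>i. X i \<omega>) k l)) (h' (stretch (\<lambda>i. X i \<omega>) k l)) j w))
        (copula_deriv C j) j n \<delta> \<epsilon>)"
    if "\<And>x k l r r'. (\<lambda>w. trunc01 (est x k l r r' j w)) \<in> borel_measurable borel"
      and "\<And>x k l r r' w. w \<in> {0..1} \<Longrightarrow> 0 < r + r' \<Longrightarrow> 0 \<le> w $ j - r' \<Longrightarrow> w $ j + r \<le> 1 \<Longrightarrow>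
          est x k l r r' j w = copula_increment x k l r r' j w / (r + r')" for est
    by (rule smooth_deriv_outer_prob[OF \<open>prob_space M\<close> assms(2) \<open>stationary M X\<close> cop
          \<open>smoothing_setup M X U \<W> W\<close> _ cont ii(1,2,5) lim(1,2) L(1) _ _ _ _ _ lim(3) _
          \<open>0 < \<delta>\<close> less_imp_le[OF \<open>\<delta> < 1\<close>] \<open>0 < \<epsilon>\<close> \<open>\<epsilon> < 1/2\<close>])
      (rule diff pos bsum hL var' that; assumption)+
  show ?thesis
    unfolding smooth_deriv_Delta_def smooth_deriv_nabla_def
  proof
    show "tendsto_zero_outer_prob M (\<lambda>n \<omega>. sup_error (\<lambda>k l u.
        LINT w:{0..1}|smooth_law M W (\<lambda>i. X i \<omega>) k l u.
          trunc01 (deriv_Delta (\<lambda>i. X i \<omega>) k l (h (stretch (\<lambda>i. X i \<omega>) k l)) (h' (stretch (\<lambda>i. X i \<omega>) k l)) j w))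
        (copula_deriv C j) j n \<delta> \<epsilon>)"
      by (rule conv[OF borel_measurable_deriv_estimators(2)]) (simp add: deriv_Delta_def)
    show "tendsto_zero_outer_prob M (\<lambda>n \<omega>. sup_error (\<lambda>k l u.
        LINT w:{0..1}|smooth_law M W (\<lambda>i. X i \<omega>) k l u.
          trunc01 (deriv_nabla (\<lambda>i. X i \<omega>) k l (h (stretch (\<lambda>i. X i \<omega>) k l)) (h' (stretch (\<lambda>i. X i \<omega>) k l)) j w))
        (copula_deriv C j) j n \<delta> \<epsilon>)"
      by (rule conv[OF borel_measurable_deriv_estimators(1)]) (simp add: deriv_nabla_def)
  qed
qed

end
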